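(* Let $L\ge 2$. Suppose that, as $b\to\infty$, the transient durations $d_i=d_i(b)\to\infty$ satisfy $d_i\sim c_i'\frac{b}{I_i}$ for constants $c_i'\in[0,\infty]$, $1\le i\le L-1$, set $c_L'=\infty$, and suppose that the weights $\rho_i=\rho_i(b)\in(0,1)$ of the WD-CuSum algorithm satisfy $\rho_i\to0$ and $\frac{-\log\rho_i}{b}\to0$ for $1\le i\le L-1$. Let $h=\min\{1\le j\le L:\sum_{i=1}^{j}c_i'\ge1\}$. Then the D-CuSum and WD-CuSum stopping times $\widehat\tau(b)$ and $\widetilde\tau(b)$ with threshold $b$ satisfy, as $b\to\infty$, $$J^{\boldsymbol d}_{\mathrm L}(\widehat\tau(b))=J^{\boldsymbol d}_{\mathrm P}(\widehat\tau(b))\le J^{\boldsymbol d}_{\mathrm L}(\widetilde\tau(b))=J^{\boldsymbol d}_{\mathrm P}(\widetilde\tau(b))\le b\left(\sum_{i=1}^{h-1}\frac{c_i'}{I_i}+\frac{1-\sum_{i=1}^{h-1}c_i'}{I_h}\right)(1+o(1)).$$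
   Context: Model. Let $L$ be a known integer and $f_0,f_1,\dots,f_L$ known probability densities with respect to a common measure. For each $1\le i\le L$ the Kullback-Leibler divergence $I_i=\int f_i\log\frac{f_i}{f_0}$ is assumed positive and finite. Independent random variables $X_1,X_2,\dots$ are observed sequentially. For a change-point $v_1\ge1$ and a vector of transient durations $\boldsymbol d=(d_1,\dots,d_{L-1})$ of nonnegative integers, set $v_0=1$, $v_{i+1}=v_i+d_i$ for $1\le i\le L-1$, and $v_{L+1}=\infty$. Under $\mathbb{P}^{\boldsymbol d}_{v_1}$ (expectation $\mathbb{E}^{\boldsymbol d}_{v_1}$) the $X_k$ are independent with $X_k\sim f_i$ if $v_i\le k<v_{i+1}$, $0\le i\le L$. Under $\mathbb{P}_\infty$ all $X_k$ are i.i.d. with density $f_0$. Worst-case average detection delays of a stopping time $\tau$ (with respect to $\mathcal F_k=\sigma(X_1,\dots,X_k)$): $J^{\boldsymbol d}_{\mathrm P}(\tau)=\sup_{v_1\ge1}\mathbb{E}^{\boldsymbol d}_{v_1}[\tau-v_1\mid\tau\ge v_1]$ (Pollak) and $J^{\boldsymbol d}_{\mathrm L}(\tau)=\sup_{v_1\ge1}\operatorname{ess\,sup}\mathbb{E}^{\boldsymbol d}_{v_1}[(\tau-v_1)^+\mid X_1,\dots,X_{v_1-1}]$ (Lorden). D-CuSum: for $1\le v_1\le k$ and $\boldsymbol d\in\mathbb N^{L-1}$ (with $0\in\mathbb N$), let $\Gamma(k,v_1,\boldsymbol d)=\prod_{i=1}^{L}\prod_{j=v_i}^{\min\{v_{i+1}-1,k\}}\frac{f_i(X_j)}{f_0(X_j)}$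 (empty products equal $1$) be the likelihood ratio of $X_1,\dots,X_k$ under $\mathbb{P}^{\boldsymbol d}_{v_1}$ versus $\mathbb{P}_\infty$. Put $\widehat W[k]=\max_{1\le v_1\le k}\max_{\boldsymbol d\in\mathbb N^{L-1}}\log\Gamma(k,v_1,\boldsymbol d)$ and, for $b>0$, $\widehat\tau(b)=\inf\{k\ge1:\widehat W[k]>b\}$. WD-CuSum: given $\rho_1,\dots,\rho_{L-1}\in(0,1)$, put $\rho_L=0$, $v_{L+1}=\infty$, and $$(\widetilde W[k])^+=\max_{1\le v_1\le v_2\le\cdots\le v_L\le k+1}\log\left(\frac{\prod_{i=1}^{L}B_i}{\prod_{j=v_1}^{k}f_0(X_j)}\right),\qquad B_i=\left(\prod_{j=v_i}^{\min\{v_{i+1}-1,k\}}f_i(X_j)(1-\rho_i)\right)\rho_i^{\mathbf 1\{k\ge v_{i+1}\}},$$ with $0^0=1$. For $b>0$, $\widetilde\tau(b)=\inf\{k\ge1:\widetilde W[k]\ge b\}$; since $b>0$, $\widetilde W[k]$ may be replaced by its positive part $(\widetilde W[k])^+$. Convention: $d_i\sim c_i'b/I_i$ means $d_iI_i/b\to c_i'$ (with $c_i'=0$ meaning $d_i=o(b)$ and $c_i'=\infty$ meaning $b=o(d_i)$). *)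

theory Defs
  imports "HOL-Probability.Probability"
begin

text \<open>A density w.r.t. \<open>\<mu>\<close> is represented by an everywhere nonnegative real function.\<close>

definition prob_density :: "'a measure \<Rightarrow> ('a \<Rightarrow> real) \<Rightarrow> bool" where
  "prob_density \<mu> g \<longleftrightarrow>
     g \<in> borel_measurable \<mu> \<and> (\<forall>x. 0 \<le> g x) \<and> (\<integral>\<^sup>+ x. ennreal (g x) \<partial>\<mu>) = 1"

text \<open>
  The divergence \<open>\<integral> g log (g / g0)\<close> is an extended-real integral (positive minus negative part), so
  that its finiteness is a genuine condition; \<^const>\<open>KL_divergence\<close> is a Bochner integral and is 0
  when the integrand is not integrable. The pointwise conventions are \<open>0 log 0 = 0\<close> and
  \<open>p log (p / 0) = \<infinity>\<close> for \<open>p > 0\<close>. The negative part always has integral at most 1, because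
  \<open>g log (g0 / g) \<le> g0 - g\<close>.
\<close>

definition kl_integrand :: "real \<Rightarrow> real \<Rightarrow> ereal" where
  "kl_integrand p q =
     (if p = 0 then 0 else if q = 0 then \<infinity> else ereal (p * ln (p / q)))"

definition KL_div :: "'a measure \<Rightarrow> ('a \<Rightarrow> real) \<Rightarrow> ('a \<Rightarrow> real) \<Rightarrow> ereal" where
  "KL_div \<mu> g g0 =
     enn2ereal (\<integral>\<^sup>+ x. e2ennreal (kl_integrand (g x) (g0 x)) \<partial>\<mu>)
     - enn2ereal (\<integral>\<^sup>+ x. e2ennreal (- kl_integrand (g x) (g0 x)) \<partial>\<mu>)"

text \<open>Logarithm with \<open>log 0 = -\<infinity>\<close>; \<^const>\<open>ln\<close> has \<open>ln 0 = 0\<close>.\<close>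

definition elog :: "real \<Rightarrow> ereal" where
  "elog x = (if x = 0 then -\<infinity> else ereal (ln x))"

text \<open>
  Only the coordinates \<open>d 1, \<dots>, d (L - 1)\<close> of a duration vector are used.
\<close>

definition change_point :: "nat \<Rightarrow> (nat \<Rightarrow> nat) \<Rightarrow> nat \<Rightarrow> nat \<Rightarrow> enat" where
  "change_point L d \<nu> i =
     (if i = 0 then 1 else if i \<le> L then enat (\<nu> + (\<Sum>j=1..<i. d j)) else \<infinity>)"

definition regime :: "nat \<Rightarrow> (nat \<Rightarrow> nat) \<Rightarrow> nat \<Rightarrow> nat \<Rightarrow> nat" where
  "regime L d \<nu> k =
     (THE i. i \<le> L \<and> change_point L d \<nu> i \<le> enat k \<and> enat k < change_point L d \<nu> (Suc i))"

text \<open>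
  The observations are the coordinates of the canonical space of sequences indexed by
  \<open>{1, 2, \<dots>}\<close>; the delays of the procedures below depend only on the law of the observations.
\<close>

definition change_measure ::
    "'a measure \<Rightarrow> (nat \<Rightarrow> 'a \<Rightarrow> real) \<Rightarrow> nat \<Rightarrow> (nat \<Rightarrow> nat) \<Rightarrow> nat \<Rightarrow> (nat \<Rightarrow> 'a) measure" where
  "change_measure \<mu> f L d \<nu> =
     PiM {1..} (\<lambda>k. density \<mu> (\<lambda>x. ennreal (f (regime L d \<nu> k) x)))"

text \<open>The \<open>\<sigma>\<close>-algebra generated by the first \<open>n\<close> observations.\<close>

definition obs_algebra :: "'a measure \<Rightarrow> nat \<Rightarrow> (nat \<Rightarrow> 'a) measure" where
  "obs_algebra \<mu> n =
     vimage_algebra (space (PiM {1..} (\<lambda>_. \<mu>))) (\<lambda>\<omega>. restrict \<omega> {1..n}) (PiM {1..n} (\<lambda>_. \<mu>))"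

text \<open>
  Pollak's delay: change-points at which the conditioning event has probability 0 are left out of
  the supremum.
\<close>

definition pollak_delay ::
    "'a measure \<Rightarrow> (nat \<Rightarrow> 'a \<Rightarrow> real) \<Rightarrow> nat \<Rightarrow> (nat \<Rightarrow> nat) \<Rightarrow> ((nat \<Rightarrow> 'a) \<Rightarrow> enat) \<Rightarrow> ennreal" where
  "pollak_delay \<mu> f L d \<tau> =
     (let P = change_measure \<mu> f L d; A = (\<lambda>\<nu>. {\<omega> \<in> space (P \<nu>). enat \<nu> \<le> \<tau> \<omega>})
      in SUP \<nu>\<in>{\<nu>. 1 \<le> \<nu> \<and> emeasure (P \<nu>) (A \<nu>) \<noteq> 0}.
           \<integral>\<^sup>+ \<omega>. ennreal_of_enat (\<tau> \<omega> - enat \<nu>) \<partial>uniform_measure (P \<nu>) (A \<nu>))"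

text \<open>Lorden's delay: subtraction on \<^typ>\<open>enat\<close> is truncated, hence it is the positive part.\<close>

definition lorden_delay ::
    "'a measure \<Rightarrow> (nat \<Rightarrow> 'a \<Rightarrow> real) \<Rightarrow> nat \<Rightarrow> (nat \<Rightarrow> nat) \<Rightarrow> ((nat \<Rightarrow> 'a) \<Rightarrow> enat) \<Rightarrow> ennreal" where
  "lorden_delay \<mu> f L d \<tau> =
     (SUP \<nu>\<in>{1..}.
        esssup (change_measure \<mu> f L d \<nu>)
          (nn_cond_exp (change_measure \<mu> f L d \<nu>) (obs_algebra \<mu> (\<nu> - 1))
            (\<lambda>\<omega>. ennreal_of_enat (\<tau> \<omega> - enat \<nu>))))"

text \<open>
  In the two statistics below, division by \<open>f 0 (X j) = 0\<close> yields 0. When the divergences are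
  finite, this happens only on a null set of each \<^const>\<open>change_measure\<close>. The maxima range over
  finitely many values and are written as suprema.
\<close>

definition lik_ratio ::
    "(nat \<Rightarrow> 'a \<Rightarrow> real) \<Rightarrow> nat \<Rightarrow> nat \<Rightarrow> nat \<Rightarrow> (nat \<Rightarrow> nat) \<Rightarrow> (nat \<Rightarrow> 'a) \<Rightarrow> real" where
  "lik_ratio f L k \<nu> d X =
     (\<Prod>i=1..L.
        \<Prod>j\<in>{j. change_point L d \<nu> i \<le> enat j \<and> enat j < change_point L d \<nu> (Suc i) \<and> j \<le> k}.
          f i (X j) / f 0 (X j))"

definition dcusum_stat ::
    "(nat \<Rightarrow> 'a \<Rightarrow> real) \<Rightarrow> nat \<Rightarrow> nat \<Rightarrow> (nat \<Rightarrow> 'a) \<Rightarrow> ereal" where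
  "dcusum_stat f L k X =
     (SUP \<nu>\<in>{1..k}. SUP d\<in>{1..<L} \<rightarrow>\<^sub>E (UNIV :: nat set). elog (lik_ratio f L k \<nu> d X))"

definition dcusum_time ::
    "(nat \<Rightarrow> 'a \<Rightarrow> real) \<Rightarrow> nat \<Rightarrow> real \<Rightarrow> (nat \<Rightarrow> 'a) \<Rightarrow> enat" where
  "dcusum_time f L b X = Inf {enat k | k. 1 \<le> k \<and> dcusum_stat f L k X > ereal b}"

text \<open>
  \<open>v\<close> holds \<open>v 1, \<dots>, v L\<close> and \<open>\<rho>\<close> the weights \<open>\<rho> 1, \<dots>, \<rho> (L - 1)\<close>; the conventions
  \<open>v (L + 1) = \<infinity>\<close> and \<open>\<rho> L = 0\<close> are built in here.
\<close>

definition wd_factor ::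
    "(nat \<Rightarrow> 'a \<Rightarrow> real) \<Rightarrow> nat \<Rightarrow> (nat \<Rightarrow> real) \<Rightarrow> nat \<Rightarrow> (nat \<Rightarrow> nat) \<Rightarrow> nat \<Rightarrow> (nat \<Rightarrow> 'a) \<Rightarrow> real" where
  "wd_factor f L \<rho> k v i X =
     (let v' = (\<lambda>i. if i \<le> L then enat (v i) else \<infinity>); r = (\<rho>(L := 0)) i
      in (\<Prod>j\<in>{j. v' i \<le> enat j \<and> enat j < v' (Suc i) \<and> j \<le> k}. f i (X j) * (1 - r))
         * r ^ (if v' (Suc i) \<le> enat k then 1 else 0))"

text \<open>
  The positive part of the WD-CuSum statistic. For positive thresholds it gives the same stopping
  time as the statistic itself. The choice \<open>v 1 = \<dots> = v L = k + 1\<close> contributes the value 0.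
\<close>

definition wdcusum_stat ::
    "(nat \<Rightarrow> 'a \<Rightarrow> real) \<Rightarrow> nat \<Rightarrow> (nat \<Rightarrow> real) \<Rightarrow> nat \<Rightarrow> (nat \<Rightarrow> 'a) \<Rightarrow> ereal" where
  "wdcusum_stat f L \<rho> k X =
     (SUP v\<in>{v \<in> {1..L} \<rightarrow>\<^sub>E {1..k + 1}. mono_on {1..L} v}.
        elog ((\<Prod>i=1..L. wd_factor f L \<rho> k v i X) / (\<Prod>j=v 1..k. f 0 (X j))))"

definition wdcusum_time ::
    "(nat \<Rightarrow> 'a \<Rightarrow> real) \<Rightarrow> nat \<Rightarrow> (nat \<Rightarrow> real) \<Rightarrow> real \<Rightarrow> (nat \<Rightarrow> 'a) \<Rightarrow> enat" where
  "wdcusum_time f L \<rho> b X = Inf {enat k | k. 1 \<le> k \<and> wdcusum_stat f L \<rho> k X \<ge> ereal b}"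

end

theory Submission
  imports Defs
begin

text \<open>
  Both stopping rules depend on the past only in one direction: discarding the observations before
  the change can only delay the alarm. By independence the delay is therefore worst for a change at
  time 1, under either criterion, and equals the expectation of the stopping time minus 1. The
  weights strictly penalise the WD-CuSum statistic, so it never stops before D-CuSum, despite the
  different inequalities at the threshold.

  For the upper bound, evaluate the WD-CuSum statistic at the true change-points. Up to a penalty
  \<open>o(b)\<close> it dominates the sum of the log-likelihood ratios over any block of observations. By a weak
  law that is uniform in the durations, a first block of length \<open>(C + \<delta>) b\<close>, with \<open>C\<close> the claimed
  constant, carries more than \<open>b\<close> units of information and fails to raise an alarm with vanishing
  probability; further blocks of length \<open>O(b)\<close> fail independently, each with probability at most
  1/2, wherever they lie relative to the change-points. Hence the expected delay is at most
  \<open>(C + \<delta>) b + o(b)\<close>.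
\<close>

section \<open>Regimes and the law of the observations\<close>

text \<open>The durations grow with b in an arbitrary way, so there is no single law of the
  observations to which a limit theorem could be applied. What stays fixed is the finite list of
  densities: only L log-likelihood ratios occur, and one truncation level serves them all.
  Truncation enters because finite divergences give first moments and no variances.

  Smallness of the failure probability of the first block does not by itself control an expectation.
  The later blocks supply geometric tails, and their total contribution keeps that probability as a
  factor.

  The constant is the time, in units of b, at which the mean information reaches b. Regime i lasts
  about c_i b / I_i observations and supplies c_i b; the regimes before h supply less than b, and
  the missing share is collected at rate I_h. When the shares up to h sum to exactly 1, regime h may
  end slightly too early; the extra \<delta> b observations, each worth at least the smallest
  divergence, cover the deficit.\<close>

lemma change_point_mono:
  assumes "1 \<le> \<nu>" "i \<le> j"
  shows "change_point L d \<nu> i \<le> change_point L d \<nu> j"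
proof -
  have "(\<Sum>l=1..<i. d l) \<le> (\<Sum>l=1..<j. d l)"
    using assms(2) by (intro sum_mono2) auto
  then show ?thesis
    using assms by (auto simp: change_point_def one_enat_def)
qed

text \<open>Regimes are consecutive half-open intervals, so at most one contains k. The bound
  \<open>1 \<le> \<nu>\<close> places v_0 = 1 before v_1 = \<nu>.\<close>

lemma regime_eqI:
  assumes "1 \<le> \<nu>" "i \<le> L" "change_point L d \<nu> i \<le> enat k" "enat k < change_point L d \<nu> (Suc i)"
  shows "regime L d \<nu> k = i"
  unfolding regime_def
proof (rule the_equality)
  fix j assume j: "j \<le> L \<and> change_point L d \<nu> j \<le> enat k \<and> enat k < change_point L d \<nu> (Suc j)"
  show "j = i"
  proof (rule ccontr)
    assume "j \<noteq> i"
    then consider "Suc i \<le> j" | "Suc j \<le> i" by linarith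
    then show False
      using j assms change_point_mono[OF assms(1)] by cases (meson leD order_trans)+
  qed
qed (use assms in auto)

text \<open>The regime at k is the largest index whose change-point is at most k. The maximum skips
  empty regimes, which arise from durations 0, and the value \<infinity> of
  \<open>change_point\<close> beyond L closes the last one.\<close>

lemma regime_props:
  assumes "1 \<le> \<nu>" "1 \<le> k"
  shows "regime L d \<nu> k \<le> L \<and> change_point L d \<nu> (regime L d \<nu> k) \<le> enat k
         \<and> enat k < change_point L d \<nu> (Suc (regime L d \<nu> k))"
proof -
  define i where "i = Max {i. i \<le> L \<and> change_point L d \<nu> i \<le> enat k}"
  have fin: "finite {i. i \<le> L \<and> change_point L d \<nu> i \<le> enat k}"
    by (rule finite_subset[of _ "{..L}"]) auto
  have ne: "0 \<in> {i. i \<le> L \<and> change_point L d \<nu> i \<le> enat k}"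
    using assms by (simp add: change_point_def one_enat_def)
  have i: "i \<le> L" "change_point L d \<nu> i \<le> enat k"
    using Max_in[OF fin] ne unfolding i_def by blast+
  have "enat k < change_point L d \<nu> (Suc i)"
  proof (rule ccontr)
    assume H: "\<not> enat k < change_point L d \<nu> (Suc i)"
    then have "Suc i \<le> L" by (auto simp: change_point_def split: if_splits)
    with H have "Suc i \<le> i"
      unfolding i_def by (intro Max_ge fin) auto
    then show False by simp
  qed
  moreover from this have "regime L d \<nu> k = i"
    using i assms by (intro regime_eqI) auto
  ultimately show ?thesis using i by simp
qed

lemma regime_le: "1 \<le> \<nu> \<Longrightarrow> 1 \<le> k \<Longrightarrow> regime L d \<nu> k \<le> L"
  using regime_props by blast

lemma regime_eq_iff:
  assumes "1 \<le> \<nu>" "1 \<le> k" "i \<le> L"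
  shows "regime L d \<nu> k = i \<longleftrightarrow> change_point L d \<nu> i \<le> enat k \<and> enat k < change_point L d \<nu> (Suc i)"
  using regime_eqI[OF assms(1,3)] regime_props[OF assms(1,2)] by blast

text \<open>For a change at time 1 the interval of f_0 is [1, 1), hence empty: every observation
  follows a post-change law.\<close>

lemma regime_ge_1: "1 \<le> k \<Longrightarrow> 1 \<le> L \<Longrightarrow> 1 \<le> regime L d 1 k"
  using regime_eq_iff[of 1 k 0 L d] by (auto simp: change_point_def not_less_eq_eq)

lemma regime_shift:
  assumes "1 \<le> k" "1 \<le> L"
  shows "regime L d (Suc n) (k + n) = regime L d 1 k"
proof (rule regime_eqI)
  define i where "i = regime L d 1 k"
  have i: "i \<le> L" "1 \<le> i" "change_point L d 1 i \<le> enat k" "enat k < change_point L d 1 (Suc i)"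
    using regime_props[of 1 k L d] regime_ge_1 assms unfolding i_def by auto
  show "change_point L d (Suc n) (regime L d 1 k) \<le> enat (k + n)"
    using i unfolding i_def[symmetric] by (auto simp: change_point_def split: if_splits)
  show "enat (k + n) < change_point L d (Suc n) (Suc (regime L d 1 k))"
    using i unfolding i_def[symmetric] by (auto simp: change_point_def split: if_splits)
  show "regime L d 1 k \<le> L" using i by (simp add: i_def)
qed simp

text \<open>The restriction to \<open>{1..}\<close> keeps the shifted path extensional, hence in the
  space of the product measure.\<close>

definition shift_seq :: "nat \<Rightarrow> (nat \<Rightarrow> 'a) \<Rightarrow> nat \<Rightarrow> 'a" where
  "shift_seq n \<omega> = (\<lambda>j\<in>{1..}. \<omega> (j + n))"

lemma sets_PiM_dens: "sets (PiM K (\<lambda>k. density \<mu> (g k))) = sets (PiM K (\<lambda>_. \<mu>))"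
  by (intro sets_PiM_cong) auto

lemma space_PiM_dens: "space (PiM K (\<lambda>k. density \<mu> (g k))) = space (PiM K (\<lambda>_. \<mu>))"
  by (simp add: space_PiM)

lemma sets_change_measure: "sets (change_measure \<mu> f L d \<nu>) = sets (PiM {1..} (\<lambda>_. \<mu>))"
  by (simp add: change_measure_def sets_PiM_dens)

lemma space_change_measure: "space (change_measure \<mu> f L d \<nu>) = space (PiM {1..} (\<lambda>_. \<mu>))"
  by (simp add: change_measure_def space_PiM_dens)

lemma shift_seq_measurable: "shift_seq n \<in> PiM {1..} (\<lambda>_. \<mu>) \<rightarrow>\<^sub>M PiM {1..} (\<lambda>_. \<mu>)"
  unfolding shift_seq_def by (intro measurable_restrict measurable_component_singleton) auto

lemma prob_space_dens: "prob_density \<mu> g \<Longrightarrow> prob_space (density \<mu> (\<lambda>x. ennreal (g x)))"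
  by (intro prob_spaceI) (simp add: prob_density_def emeasure_density cong: nn_integral_cong)

section \<open>Worst-case delays of suffix-closed stopping rules\<close>

text \<open>The stopping times are first entrance times \<open>Inf {k \<ge> 1. Q k X}\<close> of a rule \<open>Q\<close> that depends on
  \<open>X 1, \<dots>, X k\<close> only and that fires on a path as soon as it fires on one of its suffixes.\<close>

locale suffix_rule =
  fixes \<mu> :: "'a measure" and Q :: "nat \<Rightarrow> (nat \<Rightarrow> 'a) \<Rightarrow> bool"
  assumes meas: "\<And>k. Measurable.pred (PiM {1..k} (\<lambda>_. \<mu>)) (Q k)"
    and restr: "\<And>k X. Q k (restrict X {1..k}) \<longleftrightarrow> Q k X"
    and suffix: "\<And>k n X. 1 \<le> k \<Longrightarrow> Q k (shift_seq n X) \<Longrightarrow> Q (k + n) X"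
begin

definition rule_time :: "(nat \<Rightarrow> 'a) \<Rightarrow> enat" where
  "rule_time X = Inf {enat k | k. 1 \<le> k \<and> Q k X}"

text \<open>The event that the time is at least n is decided by the rule at times up to n - 1. With
  n = \<nu> this puts Pollak's conditioning event into the past of the change.\<close>

lemma rule_time_ge_iff: "enat n \<le> rule_time X \<longleftrightarrow> (\<forall>k\<in>{1..<n}. \<not> Q k X)"
  unfolding rule_time_def le_Inf_iff by (force simp: not_less[symmetric])

lemma rule_time_ge_1: "1 \<le> rule_time X"
  using rule_time_ge_iff[of 1 X] by (simp add: one_enat_def)

lemma rule_time_le: "1 \<le> k \<Longrightarrow> Q k X \<Longrightarrow> rule_time X \<le> enat k"
  unfolding rule_time_def by (rule Inf_lower) auto

lemma rule_time_enatD: "rule_time X = enat k \<Longrightarrow> 1 \<le> k \<and> Q k X"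
proof -
  assume t: "rule_time X = enat k"
  then have ne: "{enat k | k. 1 \<le> k \<and> Q k X} \<noteq> {}"
    unfolding rule_time_def by (metis Inf_enat_def enat.distinct(1))
  have "rule_time X \<in> {enat k | k. 1 \<le> k \<and> Q k X}"
    using ne unfolding rule_time_def Inf_enat_def by (auto intro: LeastI)
  then show ?thesis using t by auto
qed

text \<open>Suffix closure turns an alarm at k on the shortened path into an alarm at k + n on the
  full path, possibly not its first; hence only an inequality.\<close>

lemma rule_time_shift: "rule_time X \<le> rule_time (shift_seq n X) + enat n"
proof (cases "rule_time (shift_seq n X)")
  case (enat k)
  from rule_time_enatD[OF this] have "rule_time X \<le> enat (k + n)"
    by (intro rule_time_le suffix) auto
  then show ?thesis by (simp add: enat)
qed auto

lemma pred_Q: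
  assumes "{1..k} \<subseteq> K"
  shows "Measurable.pred (PiM K (\<lambda>_. \<mu>)) (Q k)"
proof -
  have "Measurable.pred (PiM K (\<lambda>_. \<mu>)) (\<lambda>X. Q k (restrict X {1..k}))"
    by (rule measurable_compose[OF measurable_restrict_subset[OF assms] meas])
  then show ?thesis by (simp add: restr del: One_nat_def)
qed

lemma pred_rule_time_ge:
  assumes "{1..<n} \<subseteq> K"
  shows "Measurable.pred (PiM K (\<lambda>_. \<mu>)) (\<lambda>X. enat n \<le> rule_time X)"
  unfolding rule_time_ge_iff
  using assms by (intro pred_intros_finite pred_intros_logic pred_Q) auto

lemma measurable_rule_time: "rule_time \<in> PiM {1..} (\<lambda>_. \<mu>) \<rightarrow>\<^sub>M count_space UNIV"
proof -
  let ?M = "PiM {1..} (\<lambda>_. \<mu>)"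
  have [measurable]: "Measurable.pred ?M (\<lambda>X. enat n \<le> rule_time X)" for n
    by (rule pred_rule_time_ge) auto
  have "Measurable.pred ?M (\<lambda>X. rule_time X = t)" for t
  proof (cases t)
    case (enat n)
    have "(rule_time X = t) \<longleftrightarrow> enat n \<le> rule_time X \<and> \<not> enat (Suc n) \<le> rule_time X" for X
      unfolding enat by (cases "rule_time X") auto
    then show ?thesis by (simp del: One_nat_def)
  next
    case infinity
    have "(rule_time X = t) \<longleftrightarrow> (\<forall>n. enat n \<le> rule_time X)" for X
      unfolding infinity by (cases "rule_time X") (auto simp: not_le)
    then show ?thesis by (simp del: One_nat_def)
  qed
  then show ?thesis
    by (subst measurable_count_space_eq2_countable)
       (auto simp: pred_def vimage_def Int_def conj_commute)
qed

end

section \<open>Independence of the past and the future of the change-point\<close>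

lemma subalgebra_obs_algebra: "subalgebra (PiM {1..} (\<lambda>_. \<mu>)) (obs_algebra \<mu> n)"
proof -
  have m: "(\<lambda>\<omega>. restrict \<omega> {1..n}) \<in> PiM {1..} (\<lambda>_. \<mu>) \<rightarrow>\<^sub>M PiM {1..n} (\<lambda>_. \<mu>)"
    by (rule measurable_restrict_subset) auto
  show ?thesis
    unfolding subalgebra_def obs_algebra_def
    using measurable_space[OF m] measurable_sets[OF m]
    by (auto simp: sets_vimage_algebra2)
qed

locale change_model =
  fixes \<mu> :: "'a measure" and f :: "nat \<Rightarrow> 'a \<Rightarrow> real" and L :: nat
  assumes L2: "2 \<le> L"
    and dens: "\<And>i. i \<le> L \<Longrightarrow> prob_density \<mu> (f i)"
begin

abbreviation P where "P d \<nu> \<equiv> change_measure \<mu> f L d \<nu>"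

abbreviation obs_law where "obs_law i \<equiv> density \<mu> (\<lambda>x. ennreal (f i x))"

lemma prob_obs_law: "i \<le> L \<Longrightarrow> prob_space (obs_law i)"
  by (intro prob_space_dens dens)

lemma prob_P: "1 \<le> \<nu> \<Longrightarrow> prob_space (P d \<nu>)"
  unfolding change_measure_def by (intro prob_space_PiM prob_obs_law regime_le) auto

lemma distr_coord:
  assumes "1 \<le> \<nu>" "1 \<le> k"
  shows "distr (P d \<nu>) (obs_law (regime L d \<nu> k)) (\<lambda>\<omega>. \<omega> k) = obs_law (regime L d \<nu> k)"
  unfolding change_measure_def using assms
  by (intro distr_PiM_component prob_obs_law regime_le) auto

text \<open>Reindexing a product measure by j + n leaves a product, whose factors are by
  \<open>regime_shift\<close> those of a change at time 1. The target space matters only through its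
  \<sigma>-algebra.\<close>

lemma distr_shift: "distr (P d (Suc n)) (PiM {1..} (\<lambda>_. \<mu>)) (shift_seq n) = P d 1"
proof -
  let ?M = "\<lambda>k. obs_law (regime L d (Suc n) k)"
  have eq: "(\<Pi>\<^sub>M i\<in>{1..}. ?M (i + n)) = P d 1"
    unfolding change_measure_def using L2 by (intro PiM_cong) (auto simp: regime_shift)
  have "distr (PiM {1..} ?M) (\<Pi>\<^sub>M i\<in>{1..}. ?M (i + n)) (\<lambda>\<omega>. \<lambda>i\<in>{1..}. \<omega> (i + n)) = (\<Pi>\<^sub>M i\<in>{1..}. ?M (i + n))"
    by (rule distr_PiM_reindex) (auto intro!: prob_obs_law regime_le inj_onI)
  then have "distr (P d (Suc n)) (P d 1) (shift_seq n) = P d 1"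
    unfolding eq unfolding shift_seq_def change_measure_def by simp
  moreover have "distr (P d (Suc n)) (P d 1) (shift_seq n) = distr (P d (Suc n)) (PiM {1..} (\<lambda>_. \<mu>)) (shift_seq n)"
    by (intro distr_cong sets_change_measure refl)
  ultimately show ?thesis by simp
qed

lemma indep_coords:
  assumes "1 \<le> \<nu>"
  shows "prob_space.indep_vars (P d \<nu>) (\<lambda>_. \<mu>) (\<lambda>k \<omega>. \<omega> k) {1..}"
proof -
  interpret prob_space "P d \<nu>" by (rule prob_P[OF assms])
  let ?M = "\<lambda>k. obs_law (regime L d \<nu> k)"
  have rv: "(\<lambda>\<omega>. \<omega> k) \<in> P d \<nu> \<rightarrow>\<^sub>M ?M k" if "k \<in> {1..}" for k
    unfolding change_measure_def using that by (rule measurable_component_singleton)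
  have "(\<Pi>\<^sub>M i\<in>{1..}. distr (P d \<nu>) (?M i) (\<lambda>x. x i)) = P d \<nu>"
    using assms by (subst PiM_cong[OF refl distr_coord]) (auto simp: change_measure_def)
  moreover have "distr (P d \<nu>) (PiM {1..} ?M) (\<lambda>x. \<lambda>i\<in>{1..}. x i) = P d \<nu>"
  proof (rule trans[OF distr_cong distr_id])
    show "(\<lambda>i\<in>{1..}. x i) = x" if "x \<in> space (P d \<nu>)" for x
      using that by (auto simp: space_change_measure space_PiM PiE_def extensional_restrict)
  qed (auto simp: change_measure_def)
  ultimately have "indep_vars ?M (\<lambda>k \<omega>. \<omega> k) {1..}"
    using rv by (subst indep_vars_iff_distr_eq_PiM') auto
  \<comment> \<open>The index-dependent target spaces are replaced by \<open>\<mu>\<close>, which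
    has the same measurable sets, so that one \<sigma>-algebra serves all coordinates.\<close>
  from indep_vars_compose2[OF this, of "\<lambda>_ x. x" "\<lambda>_. \<mu>"]
  show ?thesis by simp
qed

text \<open>The observations after time n are independent of the first n and have the law of a
  change at time 1. Testing against indicators of past events serves both criteria: it evaluates
  Pollak's conditional mean and characterises Lorden's conditional expectation.\<close>

lemma nn_integral_prefix_suffix:
  assumes A: "A \<in> sets (obs_algebra \<mu> n)" and G: "G \<in> borel_measurable (PiM {1..} (\<lambda>_. \<mu>))"
  shows "(\<integral>\<^sup>+\<omega>. G (shift_seq n \<omega>) * indicator A \<omega> \<partial>P d (Suc n))
          = emeasure (P d (Suc n)) A * (\<integral>\<^sup>+\<omega>. G \<omega> \<partial>P d 1)"
proof -
  let ?P = "P d (Suc n)"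
  interpret prob_space ?P by (rule prob_P) simp
  have m: "(\<lambda>\<omega>. restrict \<omega> {1..n}) \<in> PiM {1..} (\<lambda>_. \<mu>) \<rightarrow>\<^sub>M PiM {1..n} (\<lambda>_. \<mu>)"
    by (rule measurable_restrict_subset) auto
  obtain B where B: "B \<in> sets (PiM {1..n} (\<lambda>_. \<mu>))"
    and AB: "A = (\<lambda>\<omega>. restrict \<omega> {1..n}) -` B \<inter> space (PiM {1..} (\<lambda>_. \<mu>))"
    using A unfolding obs_algebra_def
    by (subst (asm) sets_vimage_algebra2) (use measurable_space[OF m] in auto)
  have A': "A \<in> sets ?P"
    using A subalgebra_obs_algebra[of \<mu> n] by (auto simp: subalgebra_def sets_change_measure)
  \<comment> \<open>Past and future are indexed by \<open>bool\<close>, so that the grouping lemma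
    for independent families applies to the two blocks of coordinates.\<close>
  let ?K = "\<lambda>t. if t then {1..n} else {Suc n..}"
  define Y :: "bool \<Rightarrow> (nat \<Rightarrow> 'a) \<Rightarrow> ennreal"
    where "Y t = (if t then indicator B else (\<lambda>\<omega>. G (\<lambda>j\<in>{1..}. \<omega> (j + n))))" for t
  have iv: "indep_vars (\<lambda>t. PiM (?K t) (\<lambda>_. \<mu>)) (\<lambda>t \<omega>. restrict (\<lambda>i. \<omega> i) (?K t)) UNIV"
    by (rule indep_vars_restrict[OF indep_coords]) (auto simp: disjoint_family_on_def)
  have Ym: "Y t \<in> borel_measurable (PiM (?K t) (\<lambda>_. \<mu>))" for t
    unfolding Y_def using B
    by (cases t) (auto intro!: measurable_compose[OF measurable_restrict G] measurable_component_singleton simp del: One_nat_def)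
  have iv2: "indep_vars (\<lambda>_. borel) (\<lambda>t \<omega>. Y t (restrict \<omega> (?K t))) UNIV"
    using indep_vars_compose2[OF iv Ym] by simp
  have T: "Y True (restrict \<omega> (?K True)) = indicator A \<omega>" if "\<omega> \<in> space ?P" for \<omega>
    using that by (auto simp: Y_def AB space_change_measure indicator_def)
  have F: "Y False (restrict \<omega> (?K False)) = G (shift_seq n \<omega>)" for \<omega>
    unfolding Y_def shift_seq_def by (auto intro!: arg_cong[of _ _ G])
  have "(\<integral>\<^sup>+\<omega>. (\<Prod>t\<in>UNIV. Y t (restrict \<omega> (?K t))) \<partial>?P)
      = (\<Prod>t\<in>UNIV. \<integral>\<^sup>+\<omega>. Y t (restrict \<omega> (?K t)) \<partial>?P)"
    by (rule indep_vars_nn_integral[OF _ iv2]) auto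
  also have "(\<integral>\<^sup>+\<omega>. (\<Prod>t\<in>UNIV. Y t (restrict \<omega> (?K t))) \<partial>?P)
      = (\<integral>\<^sup>+\<omega>. G (shift_seq n \<omega>) * indicator A \<omega> \<partial>?P)"
    using T F by (intro nn_integral_cong) (simp add: UNIV_bool mult.commute)
  also have "(\<Prod>t\<in>UNIV. \<integral>\<^sup>+\<omega>. Y t (restrict \<omega> (?K t)) \<partial>?P)
      = (\<integral>\<^sup>+\<omega>. indicator A \<omega> \<partial>?P) * (\<integral>\<^sup>+\<omega>. G (shift_seq n \<omega>) \<partial>?P)"
    using T F by (simp add: UNIV_bool mult.commute cong: nn_integral_cong)
  also have "(\<integral>\<^sup>+\<omega>. G (shift_seq n \<omega>) \<partial>?P) = (\<integral>\<^sup>+\<omega>. G \<omega> \<partial>distr ?P (PiM {1..} (\<lambda>_. \<mu>)) (shift_seq n))"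
    by (rule nn_integral_distr[symmetric])
       (use shift_seq_measurable G in \<open>auto simp: measurable_cong_sets[OF sets_change_measure refl]\<close>)
  finally show ?thesis using A' by (simp add: distr_shift del: One_nat_def)
qed

end

section \<open>Pollak's and Lorden's delay of a suffix-closed rule\<close>

locale suffix_rule_model = change_model \<mu> f L + suffix_rule \<mu> Q
  for \<mu> :: "'a measure" and f :: "nat \<Rightarrow> 'a \<Rightarrow> real" and L :: nat and Q
begin

definition mean_delay :: "(nat \<Rightarrow> nat) \<Rightarrow> ennreal" where
  "mean_delay d = (\<integral>\<^sup>+\<omega>. ennreal_of_enat (rule_time \<omega> - 1) \<partial>P d 1)"

lemma measurable_delay [measurable]:
  "(\<lambda>\<omega>. ennreal_of_enat (rule_time \<omega> - t)) \<in> borel_measurable (PiM {1..} (\<lambda>_. \<mu>))"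
  by (rule measurable_compose[OF measurable_rule_time]) simp

lemma delay_le_shift:
  "ennreal_of_enat (rule_time \<omega> - enat (Suc n)) \<le> ennreal_of_enat (rule_time (shift_seq n \<omega>) - 1)"
proof -
  have "rule_time \<omega> - enat (Suc n) \<le> rule_time (shift_seq n \<omega>) - 1"
    using rule_time_shift[of \<omega> n]
    by (cases "rule_time \<omega>"; cases "rule_time (shift_seq n \<omega>)") (auto simp: one_enat_def)
  then show ?thesis by simp
qed

lemma shift_seq_0: "\<omega> \<in> space (P d \<nu>) \<Longrightarrow> shift_seq 0 \<omega> = \<omega>"
  by (auto simp: shift_seq_def space_change_measure space_PiM PiE_def extensional_restrict)

text \<open>The conditioning event lies in the past of \<nu>, while the delay of the shifted path,
  which bounds the true delay, depends on the future; so the probability of the event cancels.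
  Equality is attained at \<nu> = 1, where the event is the whole space because the time is at least
  1.\<close>

lemma pollak_delay_eq: "pollak_delay \<mu> f L d rule_time = mean_delay d"
proof -
  let ?A = "\<lambda>\<nu>. {\<omega> \<in> space (P d \<nu>). enat \<nu> \<le> rule_time \<omega>}"
  let ?D = "\<lambda>\<nu>. \<integral>\<^sup>+ \<omega>. ennreal_of_enat (rule_time \<omega> - enat \<nu>) \<partial>uniform_measure (P d \<nu>) (?A \<nu>)"
  have A: "?A (Suc n) \<in> sets (obs_algebra \<mu> n)" for n
  proof -
    have "Measurable.pred (PiM {1..n} (\<lambda>_. \<mu>)) (\<lambda>X. enat (Suc n) \<le> rule_time X)"
      by (rule pred_rule_time_ge) auto
    then have S: "{X \<in> space (PiM {1..n} (\<lambda>_. \<mu>)). enat (Suc n) \<le> rule_time X} \<in> sets (PiM {1..n} (\<lambda>_. \<mu>))"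
      by (simp add: pred_def)
    have m: "(\<lambda>\<omega>. restrict \<omega> {1..n}) \<in> PiM {1..} (\<lambda>_. \<mu>) \<rightarrow>\<^sub>M PiM {1..n} (\<lambda>_. \<mu>)"
      by (rule measurable_restrict_subset) auto
    have Qr: "Q k (restrict \<omega> {1..n}) \<longleftrightarrow> Q k \<omega>" if "k \<le> n" for k \<omega>
    proof -
      have "restrict (restrict \<omega> {1..n}) {1..k} = restrict \<omega> {1..k}"
        using that by (auto simp: restrict_def)
      then show ?thesis by (metis restr)
    qed
    have "?A (Suc n) = (\<lambda>\<omega>. restrict \<omega> {1..n}) -`
        {X \<in> space (PiM {1..n} (\<lambda>_. \<mu>)). enat (Suc n) \<le> rule_time X} \<inter> space (PiM {1..} (\<lambda>_. \<mu>))"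
      using measurable_space[OF m] unfolding rule_time_ge_iff
      by (auto simp: space_change_measure Qr simp del: One_nat_def)
    then show ?thesis
      unfolding obs_algebra_def using in_vimage_algebra[OF S] by simp
  qed
  have le: "?D \<nu> \<le> mean_delay d" if \<nu>: "1 \<le> \<nu>" "emeasure (P d \<nu>) (?A \<nu>) \<noteq> 0" for \<nu>
  proof -
    obtain n where n: "\<nu> = Suc n" using \<nu>(1) by (cases \<nu>) auto
    interpret prob_space "P d \<nu>" using prob_P \<nu>(1) .
    have A': "?A \<nu> \<in> sets (P d \<nu>)"
      using A[of n] subalgebra_obs_algebra[of \<mu> n] unfolding n
      by (auto simp: subalgebra_def sets_change_measure)
    have "?D \<nu> = (\<integral>\<^sup>+ \<omega>. ennreal_of_enat (rule_time \<omega> - enat \<nu>) * indicator (?A \<nu>) \<omega> \<partial>P d \<nu>) / emeasure (P d \<nu>) (?A \<nu>)"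
      by (rule nn_integral_uniform_measure[OF _ A'])
         (simp add: measurable_cong_sets[OF sets_change_measure refl] measurable_delay del: One_nat_def)
    also have "\<dots> \<le> (\<integral>\<^sup>+ \<omega>. ennreal_of_enat (rule_time (shift_seq n \<omega>) - 1) * indicator (?A \<nu>) \<omega> \<partial>P d \<nu>) / emeasure (P d \<nu>) (?A \<nu>)"
      unfolding n by (intro divide_right_mono_ennreal nn_integral_mono mult_right_mono delay_le_shift) simp
    also have "\<dots> = emeasure (P d \<nu>) (?A \<nu>) * mean_delay d / emeasure (P d \<nu>) (?A \<nu>)"
      unfolding n using nn_integral_prefix_suffix[OF A[of n] measurable_delay[of 1], where d=d]
      by (simp add: mean_delay_def)
    also have "\<dots> = mean_delay d"
      using \<nu>(2) emeasure_finite[of "?A \<nu>"]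
      by (simp add: mult.commute ennreal_mult_divide_eq)
    finally show ?thesis .
  qed
  have A1: "?A 1 = space (P d 1)"
    using rule_time_ge_1 by (auto simp: one_enat_def)
  interpret prob_space "P d 1" by (rule prob_P) simp
  have "?D 1 = (\<integral>\<^sup>+ \<omega>. ennreal_of_enat (rule_time \<omega> - enat 1) * indicator (space (P d 1)) \<omega> \<partial>P d 1)"
    unfolding A1 using emeasure_space_1
    by (subst nn_integral_uniform_measure)
       (auto simp: measurable_cong_sets[OF sets_change_measure refl] measurable_delay divide_ennreal_def
             simp del: One_nat_def)
  also have "\<dots> = mean_delay d"
    unfolding mean_delay_def by (intro nn_integral_cong) (simp add: one_enat_def)
  finally have eq: "?D 1 = mean_delay d" .
  show ?thesis
    unfolding pollak_delay_def Let_def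
  proof (intro antisym SUP_least)
    show "mean_delay d \<le> (SUP \<nu>\<in>{\<nu>. 1 \<le> \<nu> \<and> emeasure (P d \<nu>) (?A \<nu>) \<noteq> 0}. ?D \<nu>)"
      by (rule SUP_upper2[of 1]) (use eq A1 emeasure_space_1 in auto)
  qed (use le in auto)
qed

text \<open>The delay of the shifted path is independent of the past, so its conditional expectation
  is the constant \<open>mean_delay d\<close>, which bounds that of the true delay. At \<nu> = 1
  nothing is dropped and the bound is an equality.\<close>

lemma lorden_delay_eq: "lorden_delay \<mu> f L d rule_time = mean_delay d"
proof -
  let ?C = "\<lambda>\<nu>. nn_cond_exp (P d \<nu>) (obs_algebra \<mu> (\<nu> - 1)) (\<lambda>\<omega>. ennreal_of_enat (rule_time \<omega> - enat \<nu>))"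
  have sub: "subalgebra (P d \<nu>) (obs_algebra \<mu> n)" for \<nu> n
    using subalgebra_obs_algebra[of \<mu> n] by (simp add: subalgebra_def sets_change_measure space_change_measure)
  have fms: "finite_measure_subalgebra (P d \<nu>) (obs_algebra \<mu> n)" if "1 \<le> \<nu>" for \<nu> n
  proof -
    interpret prob_space "P d \<nu>" by (rule prob_P[OF that])
    show ?thesis by unfold_locales (rule sub)
  qed
  have const: "AE \<omega> in P d (Suc n). mean_delay d =
      nn_cond_exp (P d (Suc n)) (obs_algebra \<mu> n) (\<lambda>\<omega>. ennreal_of_enat (rule_time (shift_seq n \<omega>) - 1)) \<omega>" for n
  proof -
    interpret finite_measure_subalgebra "P d (Suc n)" "obs_algebra \<mu> n" by (rule fms) simp
    show ?thesis
    proof (rule nn_cond_exp_charact)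
      fix A assume A: "A \<in> sets (obs_algebra \<mu> n)"
      then have "A \<in> sets (P d (Suc n))" using sub by (auto simp: subalgebra_def)
      then show "(\<integral>\<^sup>+\<omega>\<in>A. ennreal_of_enat (rule_time (shift_seq n \<omega>) - 1) \<partial>P d (Suc n))
          = (\<integral>\<^sup>+\<omega>\<in>A. mean_delay d \<partial>P d (Suc n))"
        using nn_integral_prefix_suffix[OF A measurable_delay[of 1], where d=d]
        by (simp add: mean_delay_def nn_integral_cmult mult.commute[of _ "indicator A _"] nn_integral_multc)
    qed (use measurable_compose[OF shift_seq_measurable measurable_delay] in
         \<open>auto simp: measurable_cong_sets[OF sets_change_measure refl]\<close>)
  qed
  have le: "esssup (P d \<nu>) (?C \<nu>) \<le> mean_delay d" if \<nu>: "1 \<le> \<nu>" for \<nu>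
  proof -
    obtain n where n: "\<nu> = Suc n" using \<nu>(1) by (cases \<nu>) auto
    interpret finite_measure_subalgebra "P d \<nu>" "obs_algebra \<mu> n" by (rule fms[OF \<nu>])
    have "AE \<omega> in P d \<nu>. ?C \<nu> \<omega> \<le> nn_cond_exp (P d \<nu>) (obs_algebra \<mu> n) (\<lambda>\<omega>. ennreal_of_enat (rule_time (shift_seq n \<omega>) - 1)) \<omega>"
      unfolding n diff_Suc_1
    proof (rule sigma_finite_subalgebra.nn_cond_exp_mono)
      show "sigma_finite_subalgebra (P d (Suc n)) (obs_algebra \<mu> n)"
        using fms[of "Suc n" n] finite_measure_subalgebra_is_sigma_finite by auto
    qed (use measurable_compose[OF shift_seq_measurable measurable_delay] measurable_delay delay_le_shift in
         \<open>auto simp: measurable_cong_sets[OF sets_change_measure refl]\<close>)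
    then have "AE \<omega> in P d \<nu>. ?C \<nu> \<omega> \<le> mean_delay d"
      using const[of n] unfolding n by eventually_elim simp
    then show ?thesis by (intro esssup_I) auto
  qed
  have eq: "esssup (P d 1) (?C 1) = mean_delay d"
  proof -
    interpret finite_measure_subalgebra "P d 1" "obs_algebra \<mu> 0" by (rule fms) simp
    interpret prob_space "P d 1" by (rule prob_P) simp
    \<comment> \<open>\<open>shift_seq 0\<close> is the identity only on extensional paths, that is,
      on the space of the measure.\<close>
    have "AE \<omega> in P d 1. nn_cond_exp (P d 1) (obs_algebra \<mu> 0) (\<lambda>\<omega>. ennreal_of_enat (rule_time (shift_seq 0 \<omega>) - 1)) \<omega> = ?C 1 \<omega>"
      unfolding diff_self_eq_0 using sub[of 1 0]
    proof (intro nn_cond_exp_cong)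
      show "AE \<omega> in P d 1. ennreal_of_enat (rule_time (shift_seq 0 \<omega>) - 1) = ennreal_of_enat (rule_time \<omega> - enat 1)"
        using shift_seq_0 by (intro AE_I2) (auto simp: one_enat_def)
    qed (use measurable_compose[OF shift_seq_measurable measurable_delay] measurable_delay in
         \<open>auto simp: measurable_cong_sets[OF sets_change_measure refl]\<close>)
    then have "AE \<omega> in P d 1. ?C 1 \<omega> = mean_delay d"
      using const[of 0] unfolding One_nat_def by eventually_elim simp
    then have "esssup (P d 1) (?C 1) = esssup (P d 1) (\<lambda>_. mean_delay d)"
      by (intro esssup_AE_cong) auto
    then show ?thesis using emeasure_space_1 by (simp add: esssup_const del: One_nat_def)
  qed
  show ?thesis
    unfolding lorden_delay_def
  proof (intro antisym SUP_least)
    show "mean_delay d \<le> (SUP \<nu>\<in>{1..}. esssup (P d \<nu>) (?C \<nu>))"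
      by (rule SUP_upper2[of 1]) (use eq in auto)
  qed (use le in auto)
qed

end

section \<open>The two detection statistics\<close>

lemma elog_ge_iff: "ereal b \<le> elog x \<longleftrightarrow> x \<noteq> 0 \<and> b \<le> ln x"
  by (auto simp: elog_def)

lemma elog_gt_iff: "ereal b < elog x \<longleftrightarrow> x \<noteq> 0 \<and> b < ln x"
  by (auto simp: elog_def)

text \<open>The endpoints are extended naturals in order to include the last segment, which has no
  right end. The bound \<open>1 \<le> a\<close> keeps the indices inside the domain of
  \<open>shift_seq\<close>.\<close>

lemma prod_segment_shift:
  fixes g :: "'a \<Rightarrow> 'b::comm_monoid_mult"
  assumes "1 \<le> a"
  shows "(\<Prod>j\<in>{j. a + enat n \<le> enat j \<and> enat j < t + enat n \<and> j \<le> k + n}. g (X j))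
       = (\<Prod>j\<in>{j. a \<le> enat j \<and> enat j < t \<and> j \<le> k}. g (shift_seq n X j))"
proof (rule prod.reindex_bij_witness[of _ "\<lambda>j. j + n" "\<lambda>j. j - n"])
  fix j assume j: "j \<in> {j. a + enat n \<le> enat j \<and> enat j < t + enat n \<and> j \<le> k + n}"
  obtain a' where a': "a = enat a'" using j by (cases a) auto
  then have "1 \<le> a'" using assms by (simp add: one_enat_def)
  then have nj: "a' + n \<le> j" "n < j" using j a' by auto
  then show "j - n + n = j" by simp
  show "j - n \<in> {j. a \<le> enat j \<and> enat j < t \<and> j \<le> k}"
    using j nj a' by (cases t) auto
  show "g (shift_seq n X (j - n)) = g (X j)" using nj by (simp add: shift_seq_def Suc_le_eq)
next
  fix j assume j: "j \<in> {j. a \<le> enat j \<and> enat j < t \<and> j \<le> k}"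
  show "j + n - n = j" by simp
  show "j + n \<in> {j. a + enat n \<le> enat j \<and> enat j < t + enat n \<and> j \<le> k + n}"
    using j by (cases a; cases t) auto
qed

lemma change_point_shift:
  "1 \<le> i \<Longrightarrow> change_point L d (\<nu> + n) i = change_point L d \<nu> i + enat n"
  by (simp add: change_point_def)

lemma change_point_ge_1: "1 \<le> \<nu> \<Longrightarrow> 1 \<le> change_point L d \<nu> i"
  by (auto simp: change_point_def one_enat_def)

text \<open>A candidate change-point uses no earlier observation, so each candidate on the shortened
  path reappears, moved by n, on the full path. This yields suffix closure of D-CuSum.\<close>

lemma lik_ratio_shift:
  assumes "1 \<le> \<nu>"
  shows "lik_ratio f L (k + n) (\<nu> + n) d X = lik_ratio f L k \<nu> d (shift_seq n X)"
  unfolding lik_ratio_def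
proof (rule prod.cong[OF refl])
  fix i assume "i \<in> {1..L}"
  then show "(\<Prod>j\<in>{j. change_point L d (\<nu> + n) i \<le> enat j \<and> enat j < change_point L d (\<nu> + n) (Suc i) \<and> j \<le> k + n}.
        f i (X j) / f 0 (X j))
      = (\<Prod>j\<in>{j. change_point L d \<nu> i \<le> enat j \<and> enat j < change_point L d \<nu> (Suc i) \<and> j \<le> k}.
        f i (shift_seq n X j) / f 0 (shift_seq n X j))"
    using prod_segment_shift[OF change_point_ge_1[OF assms, of L d i], where g="\<lambda>x. f i x / f 0 x" and t="change_point L d \<nu> (Suc i)" and n=n]
    by (simp add: change_point_shift)
qed

lemma lik_ratio_restrict:
  assumes "1 \<le> \<nu>"
  shows "lik_ratio f L k \<nu> d (restrict X {1..k}) = lik_ratio f L k \<nu> d X"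
  unfolding lik_ratio_def
proof (intro prod.cong refl)
  fix i j assume "j \<in> {j. change_point L d \<nu> i \<le> enat j \<and> enat j < change_point L d \<nu> (Suc i) \<and> j \<le> k}"
  then have "1 \<le> j" "j \<le> k"
    using change_point_ge_1[OF assms, of L d i] by (auto simp: one_enat_def dest: order_trans)
  then show "f i (restrict X {1..k} j) / f 0 (restrict X {1..k} j) = f i (X j) / f 0 (X j)" by simp
qed

lemma dcusum_stat_gt_iff:
  "ereal b < dcusum_stat f L k X
     \<longleftrightarrow> (\<exists>\<nu>\<in>{1..k}. \<exists>d\<in>{1..<L} \<rightarrow>\<^sub>E UNIV. ereal b < elog (lik_ratio f L k \<nu> d X))"
  by (simp add: dcusum_stat_def less_SUP_iff)

definition wd_points :: "nat \<Rightarrow> nat \<Rightarrow> (nat \<Rightarrow> nat) set" where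
  "wd_points L k = {v \<in> {1..L} \<rightarrow>\<^sub>E {1..k + 1}. mono_on {1..L} v}"

definition wd_ratio ::
    "(nat \<Rightarrow> 'a \<Rightarrow> real) \<Rightarrow> nat \<Rightarrow> (nat \<Rightarrow> real) \<Rightarrow> nat \<Rightarrow> (nat \<Rightarrow> nat) \<Rightarrow> (nat \<Rightarrow> 'a) \<Rightarrow> real" where
  "wd_ratio f L \<rho> k v X = (\<Prod>i=1..L. wd_factor f L \<rho> k v i X) / (\<Prod>j=v 1..k. f 0 (X j))"

lemma finite_wd_points: "finite (wd_points L k)"
  unfolding wd_points_def by (rule finite_subset[OF _ finite_PiE[of "{1..L}" "\<lambda>_. {1..k+1}"]]) auto

lemma wd_points_nonempty: "wd_points L k \<noteq> {}"
proof -
  have "(\<lambda>i\<in>{1..L}. k + 1) \<in> wd_points L k"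
    by (auto simp: wd_points_def mono_on_def)
  then show ?thesis by blast
qed

text \<open>A non-strict inequality passes from a supremum to a member only if the supremum is
  attained, here because finitely many vectors are admissible. The strict inequality of D-CuSum
  needs no attainment, although its duration vectors range over an infinite set.\<close>

lemma wdcusum_stat_ge_iff:
  "ereal b \<le> wdcusum_stat f L \<rho> k X \<longleftrightarrow> (\<exists>v\<in>wd_points L k. ereal b \<le> elog (wd_ratio f L \<rho> k v X))"
proof -
  let ?E = "(\<lambda>v. elog (wd_ratio f L \<rho> k v X)) ` wd_points L k"
  have "wdcusum_stat f L \<rho> k X = Sup ?E"
    by (simp add: wdcusum_stat_def wd_points_def wd_ratio_def)
  also have "\<dots> = Max ?E"
    using finite_wd_points wd_points_nonempty by (intro cSup_eq_Max) auto
  finally show ?thesis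
    using finite_wd_points wd_points_nonempty by (auto simp: Max_ge_iff)
qed

lemma wd_points_range: "v \<in> wd_points L k \<Longrightarrow> i \<in> {1..L} \<Longrightarrow> 1 \<le> v i \<and> v i \<le> k + 1"
  by (auto simp: wd_points_def)

lemma wd_points_mono: "v \<in> wd_points L k \<Longrightarrow> i \<in> {1..L} \<Longrightarrow> j \<in> {1..L} \<Longrightarrow> i \<le> j \<Longrightarrow> v i \<le> v j"
  by (auto simp: wd_points_def mono_on_def)

text \<open>Replacing v_{L+1} = \<infinity> by k + 1 makes every segment a half-open interval cut at
  k. The exponent of the weight is unaffected, since k + 1 exceeds k just as \<infinity>
  does.\<close>

lemma wd_factor_eq:
  assumes v: "v \<in> wd_points L k" and i: "i \<in> {1..L}"
  defines "w \<equiv> \<lambda>i. if i \<le> L then v i else k + 1"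
  shows "wd_factor f L \<rho> k v i X =
    (\<Prod>j=w i..<w (Suc i). f i (X j) * (1 - (\<rho>(L := 0)) i)) * (\<rho>(L := 0)) i ^ (if w (Suc i) \<le> k then 1 else 0)"
proof -
  have "{j. enat (v i) \<le> enat j \<and> enat j < (if Suc i \<le> L then enat (v (Suc i)) else \<infinity>) \<and> j \<le> k} = {w i..<w (Suc i)}"
    using wd_points_range[OF v, of "Suc i"] i by (auto simp: w_def)
  moreover have "(if Suc i \<le> L then enat (v (Suc i)) else \<infinity>) \<le> enat k \<longleftrightarrow> w (Suc i) \<le> k"
    by (auto simp: w_def)
  ultimately show ?thesis
    using i by (simp add: wd_factor_def Let_def)
qed

text \<open>The penalties depend only on the segment lengths and on which regimes have ended by the
  current time; both are invariant under a common translation.\<close>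

lemma wd_ratio_shift:
  fixes n :: nat
  assumes v: "v \<in> wd_points L k" and L: "1 \<le> L"
  defines "v' \<equiv> \<lambda>i\<in>{1..L}. v i + n"
  shows "v' \<in> wd_points L (k + n)" "wd_ratio f L \<rho> (k + n) v' X = wd_ratio f L \<rho> k v (shift_seq n X)"
proof -
  show "v' \<in> wd_points L (k + n)"
    using v by (auto simp: v'_def wd_points_def mono_on_def PiE_def Pi_def)
  have F: "wd_factor f L \<rho> (k + n) v' i X = wd_factor f L \<rho> k v i (shift_seq n X)" if i: "i \<in> {1..L}" for i
  proof -
    let ?r = "(\<rho>(L := 0)) i"
    let ?t = "if Suc i \<le> L then enat (v (Suc i)) else \<infinity>"
    have t: "(if Suc i \<le> L then enat (v' (Suc i)) else \<infinity>) = ?t + enat n"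
      using i by (auto simp: v'_def)
    have vi: "enat (v' i) = enat (v i) + enat n" using i by (simp add: v'_def)
    have "1 \<le> enat (v i)" using wd_points_range[OF v i] by (simp add: one_enat_def)
    from prod_segment_shift[OF this, where g="\<lambda>x. f i x * (1 - ?r)" and t="?t" and n=n and X=X and k=k]
    have "(\<Prod>j\<in>{j. enat (v' i) \<le> enat j \<and> enat j < ?t + enat n \<and> j \<le> k + n}. f i (X j) * (1 - ?r))
      = (\<Prod>j\<in>{j. enat (v i) \<le> enat j \<and> enat j < ?t \<and> j \<le> k}. f i (shift_seq n X j) * (1 - ?r))"
      unfolding vi .
    moreover have "?t + enat n \<le> enat (k + n) \<longleftrightarrow> ?t \<le> enat k" by auto
    ultimately show ?thesis
      using i t by (simp add: wd_factor_def Let_def)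
  qed
  have "(\<Prod>i=1..L. wd_factor f L \<rho> (k + n) v' i X) = (\<Prod>i=1..L. wd_factor f L \<rho> k v i (shift_seq n X))"
    using F by (intro prod.cong refl)
  moreover have "(\<Prod>j=v' 1..k+n. f 0 (X j)) = (\<Prod>j=v 1..k. f 0 (shift_seq n X j))"
    using L wd_points_range[OF v, of 1]
    by (intro prod.reindex_bij_witness[of _ "\<lambda>j. j + n" "\<lambda>j. j - n"]) (auto simp: v'_def shift_seq_def)
  ultimately show "wd_ratio f L \<rho> (k + n) v' X = wd_ratio f L \<rho> k v (shift_seq n X)"
    unfolding wd_ratio_def by simp
qed

lemma wd_ratio_restrict:
  assumes v: "v \<in> wd_points L k" and L: "1 \<le> L"
  shows "wd_ratio f L \<rho> k v (restrict X {1..k}) = wd_ratio f L \<rho> k v X"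
proof -
  have "wd_factor f L \<rho> k v i (restrict X {1..k}) = wd_factor f L \<rho> k v i X" if i: "i \<in> {1..L}" for i
    unfolding wd_factor_eq[OF v i]
    using wd_points_range[OF v, of i] wd_points_range[OF v, of "Suc i"] i
    by (intro arg_cong2[where f="(*)"] prod.cong refl) (auto split: if_splits)
  moreover have "(\<Prod>j=v 1..k. f 0 (restrict X {1..k} j)) = (\<Prod>j=v 1..k. f 0 (X j))"
    using L wd_points_range[OF v, of 1] by (intro prod.cong refl) auto
  moreover from calculation have "(\<Prod>i=1..L. wd_factor f L \<rho> k v i (restrict X {1..k})) = (\<Prod>i=1..L. wd_factor f L \<rho> k v i X)"
    by (intro prod.cong refl)
  ultimately show ?thesis
    unfolding wd_ratio_def by simp
qed

lemma elog_measurable [measurable]: "elog \<in> borel_measurable borel"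
  unfolding elog_def by measurable

lemma prod_concat:
  fixes g :: "nat \<Rightarrow> 'b::comm_monoid_mult" and w :: "nat \<Rightarrow> nat"
  assumes "\<And>i. i \<in> {1..m} \<Longrightarrow> w i \<le> w (Suc i)"
  shows "(\<Prod>i=1..m. \<Prod>j=w i..<w (Suc i). g j) = (\<Prod>j=w 1..<w (Suc m). g j)"
  using assms
proof (induction m)
  case (Suc m)
  have "1 \<le> i \<Longrightarrow> i \<le> Suc m \<Longrightarrow> w 1 \<le> w i" for i
    by (induction i rule: dec_induct) (use Suc.prems in \<open>auto intro: order_trans\<close>)
  then have "w 1 \<le> w (Suc m)" by simp
  then show ?case
    using Suc by (simp add: prod.atLeastLessThan_concat)
qed simp

text \<open>The second factor does not depend on the observations: each observation in regime i
  costs 1 - \<rho>_i, and leaving the regime costs \<rho>_i. Regime L pays nothing, because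
  \<open>r L\<close> is 0 and 0^0 = 1. Both the comparison with D-CuSum and the upper bound estimate
  this factor.\<close>

lemma wd_ratio_split:
  fixes \<rho> :: "nat \<Rightarrow> real"
  assumes v: "v \<in> wd_points L k" and L: "1 \<le> L"
  defines "w \<equiv> \<lambda>i. if i \<le> L then v i else k + 1"
  defines "r \<equiv> \<rho>(L := 0)"
  shows "wd_ratio f L \<rho> k v X =
    (\<Prod>i=1..L. \<Prod>j=w i..<w (Suc i). f i (X j) / f 0 (X j))
      * (\<Prod>i=1..L. (1 - r i) ^ (w (Suc i) - w i) * r i ^ (if w (Suc i) \<le> k then 1 else 0))"
proof -
  have w_mono: "w i \<le> w (Suc i)" if "i \<in> {1..L}" for i
    using that wd_points_mono[OF v, of i "Suc i"] wd_points_range[OF v, of i] by (auto simp: w_def)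
  have "(\<Prod>j=v 1..k. f 0 (X j)) = (\<Prod>i=1..L. \<Prod>j=w i..<w (Suc i). f 0 (X j))"
    using L by (subst prod_concat[of L w, OF w_mono]) (auto simp: w_def atLeastLessThanSuc_atLeastAtMost)
  moreover have "wd_factor f L \<rho> k v i X = (\<Prod>j=w i..<w (Suc i). f i (X j)) *
      ((1 - r i) ^ (w (Suc i) - w i) * r i ^ (if w (Suc i) \<le> k then 1 else 0))" if "i \<in> {1..L}" for i
    unfolding wd_factor_eq[OF v that] w_def r_def
    by (simp only: prod.distrib prod_constant card_atLeastLessThan mult.assoc)
  ultimately show ?thesis
    unfolding wd_ratio_def by (simp add: prod.distrib prod_dividef del: One_nat_def)
qed

text \<open>Every candidate of WD-CuSum is a candidate of D-CuSum: the differences of the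
  change-points are durations and telescope back to \<open>v\<close>.\<close>

lemma lik_ratio_of_wd_points:
  assumes v: "v \<in> wd_points L k" and L: "1 \<le> L"
  defines "w \<equiv> \<lambda>i. if i \<le> L then v i else k + 1"
  defines "d \<equiv> \<lambda>i\<in>{1..<L}. v (Suc i) - v i"
  shows "lik_ratio f L k (v 1) d X = (\<Prod>i=1..L. \<Prod>j=w i..<w (Suc i). f i (X j) / f 0 (X j))"
proof -
  have tel: "v 1 + (\<Sum>j=1..<i. d j) = v i" if "1 \<le> i" "i \<le> L" for i
    using that
  proof (induction i rule: dec_induct)
    case (step m)
    have "v m \<le> v (Suc m)" using step by (intro wd_points_mono[OF v]) auto
    then show ?case using step by (simp add: d_def)
  qed simp
  have cp: "change_point L d (v 1) i = (if i \<le> L then enat (v i) else \<infinity>)" if "1 \<le> i" for i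
    using tel that by (simp add: change_point_def del: One_nat_def)
  have "{j. change_point L d (v 1) i \<le> enat j \<and> enat j < change_point L d (v 1) (Suc i) \<and> j \<le> k} = {w i..<w (Suc i)}"
    if "i \<in> {1..L}" for i
    using that wd_points_range[OF v, of "Suc i"] by (auto simp: cp w_def simp del: One_nat_def)
  then show ?thesis
    unfolding lik_ratio_def by (intro prod.cong refl) auto
qed

section \<open>The two stopping rules under the model, and their order\<close>

context change_model
begin

lemma f_measurable: "i \<le> L \<Longrightarrow> f i \<in> borel_measurable \<mu>"
  using dens by (simp add: prob_density_def)

lemma f_nonneg: "i \<le> L \<Longrightarrow> 0 \<le> f i x"
  using dens by (simp add: prob_density_def)

lemma f_coord_measurable:
  "i \<le> L \<Longrightarrow> j \<in> {1..k} \<Longrightarrow> (\<lambda>X. f i (X j)) \<in> borel_measurable (PiM {1..k} (\<lambda>_. \<mu>))"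
  by (intro measurable_compose[OF measurable_component_singleton, where g="f i"] f_measurable)

lemma dcusum_rule: "suffix_rule_model \<mu> f L (\<lambda>k X. ereal b < dcusum_stat f L k X)"
proof unfold_locales
  fix k
  have "(\<lambda>X. lik_ratio f L k \<nu> d X) \<in> borel_measurable (PiM {1..k} (\<lambda>_. \<mu>))" if "\<nu> \<in> {1..k}" for \<nu> d
  proof -
    have "j \<in> {1..k}"
      if "j \<in> {j. change_point L d \<nu> i \<le> enat j \<and> enat j < change_point L d \<nu> (Suc i) \<and> j \<le> k}" for i j
      using change_point_ge_1[of \<nu> L d i] that \<open>\<nu> \<in> {1..k}\<close> by (auto simp: one_enat_def dest: order_trans)
    then show ?thesis
      unfolding lik_ratio_def
      by (intro borel_measurable_prod borel_measurable_divide f_coord_measurable) auto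
  qed
  then have "Measurable.pred (PiM {1..k} (\<lambda>_. \<mu>)) (\<lambda>X. ereal b < elog (lik_ratio f L k \<nu> d X))"
    if "\<nu> \<in> {1..k}" for \<nu> d
    using that by (intro borel_measurable_pred_less measurable_compose[OF _ elog_measurable]) auto
  \<comment> \<open>There are countably many duration vectors because only L - 1 coordinates are
    free; this makes the existential statement measurable.\<close>
  moreover have "countable ({1..<L} \<rightarrow>\<^sub>E (UNIV :: nat set))"
    by (intro countable_PiE) auto
  ultimately show "Measurable.pred (PiM {1..k} (\<lambda>_. \<mu>)) (\<lambda>X. ereal b < dcusum_stat f L k X)"
    unfolding dcusum_stat_gt_iff
    by (intro pred_intros_countable_bounded) auto
next
  fix k X
  show "ereal b < dcusum_stat f L k (restrict X {1..k}) \<longleftrightarrow> ereal b < dcusum_stat f L k X"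
    unfolding dcusum_stat_gt_iff by (intro bex_cong refl) (simp add: lik_ratio_restrict del: One_nat_def)
next
  fix k n X assume "ereal b < dcusum_stat f L k (shift_seq n X)"
  then obtain \<nu> d where "\<nu> \<in> {1..k}" "d \<in> {1..<L} \<rightarrow>\<^sub>E UNIV" "ereal b < elog (lik_ratio f L k \<nu> d (shift_seq n X))"
    unfolding dcusum_stat_gt_iff by blast
  then show "ereal b < dcusum_stat f L (k + n) X"
    unfolding dcusum_stat_gt_iff by (intro bexI[of _ "\<nu> + n"] bexI[of _ d]) (auto simp: lik_ratio_shift)
qed

lemma wdcusum_rule: "suffix_rule_model \<mu> f L (\<lambda>k X. ereal b \<le> wdcusum_stat f L \<rho> k X)"
proof unfold_locales
  fix k
  have "(\<lambda>X. wd_ratio f L \<rho> k v X) \<in> borel_measurable (PiM {1..k} (\<lambda>_. \<mu>))" if v: "v \<in> wd_points L k" for v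
    unfolding wd_ratio_def
  proof (intro borel_measurable_divide borel_measurable_prod f_coord_measurable)
    fix i assume i: "i \<in> {1..L}"
    show "(\<lambda>X. wd_factor f L \<rho> k v i X) \<in> borel_measurable (PiM {1..k} (\<lambda>_. \<mu>))"
      unfolding wd_factor_eq[OF v i]
      using wd_points_range[OF v, of i] wd_points_range[OF v, of "Suc i"] i
      by (intro borel_measurable_times borel_measurable_prod f_coord_measurable borel_measurable_const)
         (auto split: if_splits)
  qed (use wd_points_range[OF v, of 1] L2 in auto)
  then have "Measurable.pred (PiM {1..k} (\<lambda>_. \<mu>)) (\<lambda>X. ereal b \<le> elog (wd_ratio f L \<rho> k v X))"
    if "v \<in> wd_points L k" for v
    unfolding pred_def using that
    by (intro borel_measurable_le measurable_compose[OF _ elog_measurable]) auto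
  then show "Measurable.pred (PiM {1..k} (\<lambda>_. \<mu>)) (\<lambda>X. ereal b \<le> wdcusum_stat f L \<rho> k X)"
    unfolding wdcusum_stat_ge_iff by (intro pred_intros_finite finite_wd_points) auto
next
  fix k X
  show "ereal b \<le> wdcusum_stat f L \<rho> k (restrict X {1..k}) \<longleftrightarrow> ereal b \<le> wdcusum_stat f L \<rho> k X"
    unfolding wdcusum_stat_ge_iff using L2
    by (intro bex_cong refl) (simp add: wd_ratio_restrict del: One_nat_def)
next
  fix k n X assume "ereal b \<le> wdcusum_stat f L \<rho> k (shift_seq n X)"
  then obtain v where v: "v \<in> wd_points L k" "ereal b \<le> elog (wd_ratio f L \<rho> k v (shift_seq n X))"
    unfolding wdcusum_stat_ge_iff by blast
  then show "ereal b \<le> wdcusum_stat f L \<rho> (k + n) X"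
    unfolding wdcusum_stat_ge_iff using wd_ratio_shift[OF v(1)] L2 by (metis one_le_numeral order_trans)
qed

text \<open>The penalty factor is strictly below 1, and this strictness absorbs the difference
  between \<ge> at the threshold of WD-CuSum and > at that of D-CuSum. It comes from regime 1, which
  carries a genuine weight since L \<ge> 2.\<close>

lemma dcusum_stat_gt_of_wdcusum_stat_ge:
  assumes b: "0 < b" and \<rho>: "\<And>i. 1 \<le> i \<Longrightarrow> i < L \<Longrightarrow> 0 < \<rho> i \<and> \<rho> i < 1"
    and ge: "ereal b \<le> wdcusum_stat f L \<rho> k X"
  shows "ereal b < dcusum_stat f L k X"
proof -
  obtain v where v: "v \<in> wd_points L k" and R: "wd_ratio f L \<rho> k v X \<noteq> 0" "b \<le> ln (wd_ratio f L \<rho> k v X)"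
    using ge unfolding wdcusum_stat_ge_iff elog_ge_iff by blast
  define w where "w = (\<lambda>i. if i \<le> L then v i else k + 1)"
  define r where "r = \<rho>(L := 0)"
  define d where "d = (\<lambda>i\<in>{1..<L}. v (Suc i) - v i)"
  define lik where "lik = lik_ratio f L k (v 1) d X"
  define q where "q i = (1 - r i) ^ (w (Suc i) - w i) * r i ^ (if w (Suc i) \<le> k then 1 else 0)" for i
  have L1: "1 \<le> L" "L \<noteq> 1" using L2 by auto
  have split: "wd_ratio f L \<rho> k v X = lik * (\<Prod>i=1..L. q i)"
    unfolding lik_def d_def lik_ratio_of_wd_points[OF v L1(1)] wd_ratio_split[OF v L1(1)] w_def q_def r_def ..
  have rr: "0 \<le> r i \<and> r i < 1" if "i \<in> {1..L}" for i
    using \<rho>[of i] that by (auto simp: r_def)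
  have q01: "0 \<le> q i \<and> q i \<le> 1" if "i \<in> {1..L}" for i
    unfolding q_def using rr[OF that] by (auto intro!: mult_le_one power_le_one mult_nonneg_nonneg)
  have lik0: "0 \<le> lik"
    unfolding lik_def lik_ratio_def by (intro prod_nonneg divide_nonneg_nonneg f_nonneg ballI) auto
  have qpos: "0 \<le> (\<Prod>i=1..L. q i)" using q01 by (intro prod_nonneg) auto
  then have pos: "0 < lik" "0 < (\<Prod>i=1..L. q i)"
    using R(1) lik0 unfolding split by (auto simp: less_le)
  \<comment> \<open>The empty candidate, with all points at k + 1, has ratio 1 and logarithm 0, so b
    > 0 rules it out.\<close>
  have v1: "v 1 \<le> k"
  proof (rule ccontr)
    assume "\<not> v 1 \<le> k"
    then have w: "w i = k + 1" if "1 \<le> i" for i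
      using wd_points_range[OF v, of i] wd_points_mono[OF v, of 1 i] that L1 by (auto simp: w_def)
    have "lik = (\<Prod>i=1..L. \<Prod>j=w i..<w (Suc i). f i (X j) / f 0 (X j))"
      unfolding lik_def d_def lik_ratio_of_wd_points[OF v L1(1)] w_def ..
    also have "\<dots> = 1" using w by simp
    finally have "lik = 1" .
    moreover have "(\<Prod>i=1..L. q i) = 1" using w by (simp add: q_def)
    ultimately show False using R b unfolding split by simp
  qed
  \<comment> \<open>Either regime 1 ended by time k and paid \<rho>_1, or it contains at least the
    observation at k and paid 1 - \<rho>_1.\<close>
  have "q 1 < 1"
  proof (cases "w (Suc 1) \<le> k")
    case True
    have "q 1 \<le> 1 * r 1"
      unfolding q_def using True rr[of 1] L1
      by (auto intro!: mult_left_le_one_le power_le_one)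
    then show ?thesis using rr[of 1] L1 by auto
  next
    case False
    then have "w (Suc 1) - w 1 > 0" using v1 L1 by (simp add: w_def)
    then have "(1 - r 1) ^ (w (Suc 1) - w 1) < 1"
      using \<rho>[of 1] L2 by (intro power_less_one_iff[THEN iffD2]) (auto simp: r_def)
    then show ?thesis using False by (simp add: q_def)
  qed
  moreover have "(\<Prod>i=1..L. q i) \<le> q 1"
  proof -
    have "(\<Prod>i=1..L. q i) = q 1 * (\<Prod>i\<in>{1..L} - {1}. q i)"
      using L1 by (intro prod.remove) auto
    also have "\<dots> \<le> q 1 * 1"
      using q01 L1 by (intro mult_left_mono prod_le_1) auto
    finally show ?thesis by simp
  qed
  ultimately have "wd_ratio f L \<rho> k v X < lik"
    unfolding split using pos by simp
  moreover have "0 < wd_ratio f L \<rho> k v X" unfolding split using pos by simp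
  ultimately have "b < ln lik" using R(2) by (smt (verit) ln_less_cancel_iff)
  then show ?thesis
    unfolding dcusum_stat_gt_iff elog_gt_iff using v1 wd_points_range[OF v, of 1] L1 pos
    by (intro bexI[of _ "v 1"] bexI[of _ d]) (auto simp: lik_def d_def)
qed

lemma dcusum_time_le_wdcusum_time:
  assumes "0 < b" "\<And>i. 1 \<le> i \<Longrightarrow> i < L \<Longrightarrow> 0 < \<rho> i \<and> \<rho> i < 1"
  shows "dcusum_time f L b X \<le> wdcusum_time f L \<rho> b X"
  unfolding dcusum_time_def wdcusum_time_def
  using dcusum_stat_gt_of_wdcusum_stat_ge[of b \<rho>] assms by (intro Inf_superset_mono) blast

end

section \<open>A weak law for the log-likelihood ratios\<close>

text \<open>A finite divergence forces q > 0 almost everywhere on p > 0, since the integrand is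
  \<infinity> where this fails. The negative part is at most q by ln x \<le> x - 1. Both parts being
  finite, the extended integral is an ordinary Bochner integral.\<close>

lemma KL_div_finite:
  assumes p: "prob_density \<mu> p" and q: "prob_density \<mu> q" and fin: "KL_div \<mu> p q < \<infinity>"
  shows "AE x in density \<mu> (\<lambda>x. ennreal (p x)). 0 < p x \<and> 0 < q x"
    and "integrable (density \<mu> (\<lambda>x. ennreal (p x))) (\<lambda>x. ln (p x / q x))"
    and "(\<integral>x. ln (p x / q x) \<partial>density \<mu> (\<lambda>x. ennreal (p x))) = real_of_ereal (KL_div \<mu> p q)"
proof -
  have [measurable]: "p \<in> borel_measurable \<mu>" "q \<in> borel_measurable \<mu>"
    and p0: "0 \<le> p x" and q0: "0 \<le> q x" and q1: "(\<integral>\<^sup>+ x. ennreal (q x) \<partial>\<mu>) = 1" for x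
    using p q by (auto simp: prob_density_def)
  define K where "K x = kl_integrand (p x) (q x)" for x
  define g where "g x = p x * ln (p x / q x)" for x
  have [measurable]: "K \<in> borel_measurable \<mu>" "g \<in> borel_measurable \<mu>"
    unfolding K_def kl_integrand_def g_def by measurable
  have "e2ennreal (- K x) \<le> ennreal (q x)" for x
  proof -
    consider "p x = 0" | "p x > 0" "q x = 0" | "p x > 0" "q x > 0"
      using p0[of x] q0[of x] by fastforce
    then have "- K x \<le> ereal (q x)"
    proof cases
      case 3
      have "- (p x * ln (p x / q x)) = p x * ln (q x / p x)"
        using 3 by (simp add: ln_div algebra_simps)
      also have "\<dots> \<le> p x * (q x / p x - 1)"
        using 3 by (intro mult_left_mono ln_le_minus_one) auto
      also have "\<dots> \<le> q x" using 3 by (simp add: field_simps)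
      finally show ?thesis using 3 by (simp add: K_def kl_integrand_def)
    qed (auto simp: K_def kl_integrand_def q0)
    then show ?thesis
      by (metis e2ennreal_ereal e2ennreal_mono)
  qed
  then have "(\<integral>\<^sup>+x. e2ennreal (- K x) \<partial>\<mu>) \<le> (\<integral>\<^sup>+x. ennreal (q x) \<partial>\<mu>)"
    by (intro nn_integral_mono)
  then have B: "(\<integral>\<^sup>+x. e2ennreal (- K x) \<partial>\<mu>) \<noteq> \<infinity>"
    unfolding q1 by (auto simp: top_unique)
  have KL: "KL_div \<mu> p q = enn2ereal (\<integral>\<^sup>+x. e2ennreal (K x) \<partial>\<mu>) - enn2ereal (\<integral>\<^sup>+x. e2ennreal (- K x) \<partial>\<mu>)"
    by (simp add: KL_div_def K_def)
  have A: "(\<integral>\<^sup>+x. e2ennreal (K x) \<partial>\<mu>) \<noteq> \<infinity>"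
  proof
    assume "(\<integral>\<^sup>+x. e2ennreal (K x) \<partial>\<mu>) = \<infinity>"
    then show False using fin unfolding KL by simp
  qed
  have "AE x in \<mu>. e2ennreal (K x) \<noteq> \<infinity>"
    by (rule nn_integral_PInf_AE) (use A in auto)
  then have fin': "AE x in \<mu>. K x = ereal (g x) \<and> (0 < p x \<longrightarrow> 0 < q x)"
  proof eventually_elim
    case (elim x)
    have "K x \<noteq> \<infinity>" using elim by auto
    then show ?case
      using p0[of x] q0[of x] by (auto simp: K_def kl_integrand_def g_def less_le split: if_splits)
  qed
  have eqA: "(\<integral>\<^sup>+x. e2ennreal (K x) \<partial>\<mu>) = (\<integral>\<^sup>+x. ennreal (g x) \<partial>\<mu>)"
    using fin' by (intro nn_integral_cong_AE) (auto simp: e2ennreal_ereal)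
  have eqB: "(\<integral>\<^sup>+x. e2ennreal (- K x) \<partial>\<mu>) = (\<integral>\<^sup>+x. ennreal (- g x) \<partial>\<mu>)"
    using fin' by (intro nn_integral_cong_AE) (auto simp: e2ennreal_ereal)
  have g: "integrable \<mu> g"
    unfolding real_integrable_def using A B eqA eqB by simp
  have "KL_div \<mu> p q = ereal (\<integral>x. g x \<partial>\<mu>)"
    unfolding KL eqA eqB real_lebesgue_integral_def[OF g]
    using A B eqA eqB
    by (cases "\<integral>\<^sup>+x. ennreal (g x) \<partial>\<mu>"; cases "\<integral>\<^sup>+x. ennreal (- g x) \<partial>\<mu>")
       (auto simp: enn2ereal_ennreal)
  then have KL': "real_of_ereal (KL_div \<mu> p q) = (\<integral>x. g x \<partial>\<mu>)" by simp
  show "AE x in density \<mu> (\<lambda>x. ennreal (p x)). 0 < p x \<and> 0 < q x"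
    using fin' by (subst AE_density) (auto simp: ennreal_less_zero_iff)
  show "integrable (density \<mu> (\<lambda>x. ennreal (p x))) (\<lambda>x. ln (p x / q x))"
    using g p0 by (subst integrable_density) (auto simp: g_def[abs_def])
  show "(\<integral>x. ln (p x / q x) \<partial>density \<mu> (\<lambda>x. ennreal (p x))) = real_of_ereal (KL_div \<mu> p q)"
    unfolding KL' using p0 by (subst integral_density) (auto simp: g_def[abs_def])
qed

section \<open>Truncation and a weak law in mean for independent summands\<close>

definition clip :: "real \<Rightarrow> real \<Rightarrow> real" where
  "clip M x = max (- M) (min M x)"

lemma clip_measurable [measurable]: "clip M \<in> borel_measurable borel"
  unfolding clip_def[abs_def] by measurable

lemma abs_clip_le: "0 \<le> M \<Longrightarrow> \<bar>clip M x\<bar> \<le> M"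
  by (auto simp: clip_def)

lemma clip_error_le: "0 \<le> M \<Longrightarrow> \<bar>x - clip M x\<bar> \<le> \<bar>x\<bar>"
  by (auto simp: clip_def)

lemma clip_error_tendsto:
  fixes Z :: "'a \<Rightarrow> real"
  assumes Z: "integrable N Z"
  shows "(\<lambda>n. \<integral>x. \<bar>Z x - clip (real n) (Z x)\<bar> \<partial>N) \<longlonglongrightarrow> 0"
proof -
  have [measurable]: "Z \<in> borel_measurable N" using Z by auto
  have "(\<lambda>n. \<integral>x. \<bar>Z x - clip (real n) (Z x)\<bar> \<partial>N) \<longlonglongrightarrow> (\<integral>x. 0 \<partial>N)"
  proof (rule integral_dominated_convergence[where w="\<lambda>x. \<bar>Z x\<bar>"])
    show "AE x in N. (\<lambda>n. \<bar>Z x - clip (real n) (Z x)\<bar>) \<longlonglongrightarrow> 0"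
    proof (intro AE_I2 tendsto_eventually)
      fix x
      have "eventually (\<lambda>n. \<bar>Z x\<bar> \<le> real n) sequentially"
        using real_arch_simple[of "\<bar>Z x\<bar>"] eventually_sequentially
        by (metis of_nat_mono order_trans)
      then show "eventually (\<lambda>n. \<bar>Z x - clip (real n) (Z x)\<bar> = 0) sequentially"
        by eventually_elim (auto simp: clip_def)
    qed
  qed (use Z in \<open>auto simp: clip_error_le\<close>)
  then show ?thesis by simp
qed

context prob_space
begin

text \<open>This is nonnegativity of the variance of |S|; boundedness provides the
  integrability.\<close>

lemma expectation_abs_le_sqrt:
  fixes S :: "'a \<Rightarrow> real"
  assumes [measurable]: "S \<in> borel_measurable M" and bd: "\<And>x. \<bar>S x\<bar> \<le> C"
  shows "expectation (\<lambda>x. \<bar>S x\<bar>) \<le> sqrt (expectation (\<lambda>x. (S x)\<^sup>2))"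
proof -
  have "integrable M (\<lambda>x. \<bar>S x\<bar>)"
    by (rule integrable_const_bound[of _ C]) (use bd in auto)
  moreover have "\<bar>S x\<bar>\<^sup>2 \<le> C\<^sup>2" for x
    using bd[of x] by (intro power_mono) auto
  then have "integrable M (\<lambda>x. \<bar>S x\<bar>\<^sup>2)"
    by (intro integrable_const_bound[of _ "C\<^sup>2"]) auto
  ultimately have "variance (\<lambda>x. \<bar>S x\<bar>) = expectation (\<lambda>x. \<bar>S x\<bar>\<^sup>2) - (expectation (\<lambda>x. \<bar>S x\<bar>))\<^sup>2"
    by (rule variance_eq)
  then have "(expectation (\<lambda>x. \<bar>S x\<bar>))\<^sup>2 \<le> expectation (\<lambda>x. (S x)\<^sup>2)"
    using variance_positive[of "\<lambda>x. \<bar>S x\<bar>"] by simp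
  then show ?thesis by (rule real_le_rsqrt)
qed

text \<open>Independence and centring annihilate the off-diagonal products, so the second moment of
  the sum grows only linearly in the number of terms.\<close>

lemma expectation_abs_sum_bounded_le:
  fixes W :: "'i \<Rightarrow> 'a \<Rightarrow> real"
  assumes J: "finite J" and ind: "indep_vars (\<lambda>_. borel) W J"
    and bd: "\<And>j x. j \<in> J \<Longrightarrow> \<bar>W j x\<bar> \<le> C" and mean: "\<And>j. j \<in> J \<Longrightarrow> expectation (W j) = 0"
    and C: "0 \<le> C"
  shows "expectation (\<lambda>x. \<bar>\<Sum>j\<in>J. W j x\<bar>) \<le> C * sqrt (card J)"
proof -
  have [measurable]: "W j \<in> borel_measurable M" if "j \<in> J" for j
    using ind that by (auto simp: indep_vars_def)
  have int: "integrable M (W j)" if "j \<in> J" for j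
    using that bd by (intro integrable_const_bound[of _ C]) auto
  have int2: "integrable M (\<lambda>x. W i x * W j x)" if "i \<in> J" "j \<in> J" for i j
    using that bd C by (intro integrable_const_bound[of _ "C * C"]) (auto simp: abs_mult intro!: mult_mono)
  have cov: "expectation (\<lambda>x. W i x * W j x) \<le> (if i = j then C\<^sup>2 else 0)" if ij: "i \<in> J" "j \<in> J" for i j
  proof (cases "i = j")
    case True
    have "expectation (\<lambda>x. W i x * W i x) \<le> expectation (\<lambda>x. C\<^sup>2)"
    proof (rule integral_mono)
      show "W i x * W i x \<le> C\<^sup>2" for x
        using bd[OF ij(1), of x] C by (metis abs_le_square_iff abs_of_nonneg power2_eq_square)
    qed (use int2 ij in auto)
    then show ?thesis using True by (simp add: prob_space)
  next
    case False
    have "expectation (\<lambda>x. \<Prod>k\<in>{i, j}. W k x) = (\<Prod>k\<in>{i, j}. expectation (W k))"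
      using ij int by (intro indep_vars_lebesgue_integral indep_vars_subset[OF ind]) auto
    then show ?thesis using False ij mean by simp
  qed
  have "expectation (\<lambda>x. (\<Sum>j\<in>J. W j x)\<^sup>2) = (\<Sum>i\<in>J. \<Sum>j\<in>J. expectation (\<lambda>x. W i x * W j x))"
    unfolding power2_eq_square sum_product
    using int2 by (subst Bochner_Integration.integral_sum; (intro Bochner_Integration.integrable_sum)?; simp)+
  also have "\<dots> \<le> (\<Sum>i\<in>J. \<Sum>j\<in>J. if i = j then C\<^sup>2 else 0)"
    by (intro sum_mono cov)
  also have "\<dots> = C\<^sup>2 * card J" using J by simp
  finally have "sqrt (expectation (\<lambda>x. (\<Sum>j\<in>J. W j x)\<^sup>2)) \<le> C * sqrt (card J)"
    using C by (metis real_sqrt_le_mono real_sqrt_mult real_sqrt_abs abs_of_nonneg)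
  moreover have "expectation (\<lambda>x. \<bar>\<Sum>j\<in>J. W j x\<bar>) \<le> sqrt (expectation (\<lambda>x. (\<Sum>j\<in>J. W j x)\<^sup>2))"
  proof (rule expectation_abs_le_sqrt)
    show "\<bar>\<Sum>j\<in>J. W j x\<bar> \<le> (\<Sum>j\<in>J. C)" for x
      by (rule order_trans[OF sum_abs sum_mono]) (use bd in auto)
  qed auto
  ultimately show ?thesis by simp
qed

text \<open>Truncation reduces the weak law for independent integrable variables to the bounded case.\<close>

lemma expectation_abs_sum_centered_le:
  fixes X :: "'i \<Rightarrow> 'a \<Rightarrow> real"
  assumes J: "finite J" and ind: "indep_vars (\<lambda>_. borel) X J"
    and int: "\<And>j. j \<in> J \<Longrightarrow> integrable M (X j)"
    and C: "0 \<le> C" and clip: "\<And>j. j \<in> J \<Longrightarrow> expectation (\<lambda>x. \<bar>X j x - clip C (X j x)\<bar>) \<le> \<eta>"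
  shows "expectation (\<lambda>x. \<bar>\<Sum>j\<in>J. X j x - expectation (X j)\<bar>) \<le> 2 * \<eta> * card J + 2 * C * sqrt (card J)"
proof -
  define Y where "Y j x = clip C (X j x)" for j x
  define W where "W j x = Y j x - expectation (Y j)" for j x
  have [measurable]: "X j \<in> borel_measurable M" if "j \<in> J" for j
    using ind that by (auto simp: indep_vars_def)
  have [measurable]: "Y j \<in> borel_measurable M" if "j \<in> J" for j
    unfolding Y_def[abs_def] using that by measurable
  have intY: "integrable M (Y j)" if "j \<in> J" for j
    using that C by (intro integrable_const_bound[of _ C]) (auto simp: Y_def abs_clip_le)
  have intW: "integrable M (W j)" if "j \<in> J" for j
    using intY[OF that] unfolding W_def[abs_def] by auto
  have EY: "\<bar>expectation (Y j)\<bar> \<le> C" if "j \<in> J" for j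
  proof -
    have "\<bar>expectation (Y j)\<bar> \<le> expectation (\<lambda>x. \<bar>Y j x\<bar>)" by (rule integral_abs_bound)
    also have "\<dots> \<le> expectation (\<lambda>x. C)"
      using abs_clip_le[OF C]
      by (intro integral_mono integrable_abs integrable_const intY[OF that]) (simp add: Y_def)
    finally show ?thesis by (simp add: prob_space)
  qed
  have W: "expectation (\<lambda>x. \<bar>\<Sum>j\<in>J. W j x\<bar>) \<le> (2 * C) * sqrt (card J)"
  proof (rule expectation_abs_sum_bounded_le[OF J])
    show "indep_vars (\<lambda>_. borel) W J"
      unfolding W_def[abs_def] Y_def
      by (rule indep_vars_compose2[OF ind, where Y="\<lambda>j x. clip C x - expectation (\<lambda>x. clip C (X j x))"]) simp
    show "\<bar>W j x\<bar> \<le> 2 * C" if "j \<in> J" for j x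
      using EY[OF that] abs_clip_le[OF C, of "X j x"] by (simp add: W_def Y_def)
    show "expectation (W j) = 0" if "j \<in> J" for j
      using intY[OF that] by (simp add: W_def[abs_def] prob_space)
  qed (use C in auto)
  \<comment> \<open>The clipping error enters twice, through the variable and through its mean.
    Centring likewise doubles the bound on the clipped variable.\<close>
  have diff: "expectation (\<lambda>x. \<bar>(X j x - expectation (X j)) - W j x\<bar>) \<le> 2 * \<eta>" if j: "j \<in> J" for j
  proof -
    have i: "integrable M (\<lambda>x. \<bar>X j x - Y j x\<bar>)" using int[OF j] intY[OF j] by auto
    have "\<bar>expectation (X j) - expectation (Y j)\<bar> = \<bar>expectation (\<lambda>x. X j x - Y j x)\<bar>"
      using int[OF j] intY[OF j] by simp
    also have "\<dots> \<le> expectation (\<lambda>x. \<bar>X j x - Y j x\<bar>)" by (rule integral_abs_bound)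
    also have "\<dots> \<le> \<eta>" using clip[OF j] by (simp add: Y_def)
    finally have e: "\<bar>expectation (X j) - expectation (Y j)\<bar> \<le> \<eta>" .
    have "expectation (\<lambda>x. \<bar>(X j x - expectation (X j)) - W j x\<bar>) \<le> expectation (\<lambda>x. \<bar>X j x - Y j x\<bar> + \<eta>)"
    proof (rule integral_mono)
      show "integrable M (\<lambda>x. \<bar>(X j x - expectation (X j)) - W j x\<bar>)"
        using int[OF j] intW[OF j] by auto
      show "\<bar>(X j x - expectation (X j)) - W j x\<bar> \<le> \<bar>X j x - Y j x\<bar> + \<eta>" for x
        using e by (simp add: W_def)
    qed (use i in auto)
    also have "\<dots> \<le> 2 * \<eta>"
      using i clip[OF j] by (simp add: Y_def prob_space)
    finally show ?thesis .
  qed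
  have "expectation (\<lambda>x. \<bar>\<Sum>j\<in>J. X j x - expectation (X j)\<bar>)
      \<le> expectation (\<lambda>x. (\<Sum>j\<in>J. \<bar>(X j x - expectation (X j)) - W j x\<bar>) + \<bar>\<Sum>j\<in>J. W j x\<bar>)"
  proof (rule integral_mono)
    fix x
    have "(\<Sum>j\<in>J. X j x - expectation (X j)) = (\<Sum>j\<in>J. (X j x - expectation (X j)) - W j x) + (\<Sum>j\<in>J. W j x)"
      by (simp add: sum_subtractf)
    then show "\<bar>\<Sum>j\<in>J. X j x - expectation (X j)\<bar> \<le> (\<Sum>j\<in>J. \<bar>(X j x - expectation (X j)) - W j x\<bar>) + \<bar>\<Sum>j\<in>J. W j x\<bar>"
      using sum_abs[of "\<lambda>j. (X j x - expectation (X j)) - W j x" J] by linarith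
  qed (use int intW in auto)
  also have "\<dots> = (\<Sum>j\<in>J. expectation (\<lambda>x. \<bar>(X j x - expectation (X j)) - W j x\<bar>)) + expectation (\<lambda>x. \<bar>\<Sum>j\<in>J. W j x\<bar>)"
    using int intW by (subst Bochner_Integration.integral_add) (auto intro!: Bochner_Integration.integral_sum)
  also have "\<dots> \<le> (\<Sum>j\<in>J. 2 * \<eta>) + 2 * C * sqrt (card J)"
    using W by (intro add_mono sum_mono diff) auto
  finally show ?thesis by (simp add: mult.commute)
qed

end

section \<open>Sums of log-likelihood ratios for a change at time 1\<close>

locale kl_model = change_model +
  assumes KL: "\<And>i. 1 \<le> i \<Longrightarrow> i \<le> L \<Longrightarrow> 0 < KL_div \<mu> (f i) (f 0) \<and> KL_div \<mu> (f i) (f 0) < \<infinity>"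
begin

text \<open>Where a density vanishes, \<open>ln\<close> gives 0 and not -\<infinity>; sums of
  \<open>llr\<close> are therefore compared with the statistic only on paths along which all
  densities are positive.\<close>

definition llr :: "nat \<Rightarrow> 'a \<Rightarrow> real" where "llr i x = ln (f i x / f 0 x)"

definition info :: "nat \<Rightarrow> real" where "info i = real_of_ereal (KL_div \<mu> (f i) (f 0))"

lemma info_pos: "1 \<le> i \<Longrightarrow> i \<le> L \<Longrightarrow> 0 < info i"
  using KL[of i] unfolding info_def by (cases "KL_div \<mu> (f i) (f 0)") auto

lemma llr_measurable: "i \<le> L \<Longrightarrow> llr i \<in> borel_measurable \<mu>"
  unfolding llr_def[abs_def]
  by (intro borel_measurable_ln borel_measurable_divide f_measurable) auto

lemma AE_densities_pos: "1 \<le> i \<Longrightarrow> i \<le> L \<Longrightarrow> AE x in obs_law i. 0 < f i x \<and> 0 < f 0 x"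
  using KL by (intro KL_div_finite dens) auto

lemma integrable_llr: "1 \<le> i \<Longrightarrow> i \<le> L \<Longrightarrow> integrable (obs_law i) (llr i)"
  unfolding llr_def[abs_def] using KL by (intro KL_div_finite dens) auto

lemma integral_llr: "1 \<le> i \<Longrightarrow> i \<le> L \<Longrightarrow> (\<integral>x. llr i x \<partial>obs_law i) = info i"
  unfolding llr_def[abs_def] info_def using KL by (intro KL_div_finite dens) auto

abbreviation reg where "reg d j \<equiv> regime L d 1 j"

lemma reg_range: "1 \<le> j \<Longrightarrow> 1 \<le> reg d j \<and> reg d j \<le> L"
  using regime_ge_1[of j L d] regime_le[of 1 j L d] L2 by auto

lemma coord_measurable: "1 \<le> j \<Longrightarrow> (\<lambda>\<omega>. \<omega> j) \<in> P d \<nu> \<rightarrow>\<^sub>M obs_law i"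
  by (subst measurable_cong_sets[OF sets_change_measure sets_density]) (rule measurable_component_singleton, simp)

lemma integrable_llr_coord: "1 \<le> j \<Longrightarrow> integrable (P d 1) (\<lambda>\<omega>. llr (reg d j) (\<omega> j))"
  using integrable_distr[OF coord_measurable, of j d 1 "reg d j" "llr (reg d j)"]
    distr_coord[of 1 j d] integrable_llr reg_range by simp

lemma integral_coord:
  assumes j: "1 \<le> j" and g: "g \<in> borel_measurable \<mu>"
  shows "(\<integral>\<omega>. g (\<omega> j) \<partial>P d 1) = (\<integral>x. (g x :: real) \<partial>obs_law (reg d j))"
  using integral_distr[OF coord_measurable[OF j], of g "reg d j" d 1] g distr_coord[of 1 j d] j by simp

lemma AE_coord_densities_pos:
  "AE \<omega> in P d 1. \<forall>j\<ge>1. 0 < f (reg d j) (\<omega> j) \<and> 0 < f 0 (\<omega> j)"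
  unfolding AE_all_countable
proof
  fix j :: nat
  show "AE \<omega> in P d 1. 1 \<le> j \<longrightarrow> 0 < f (reg d j) (\<omega> j) \<and> 0 < f 0 (\<omega> j)"
  proof (cases "1 \<le> j")
    case True
    have "AE \<omega> in P d 1. 0 < f (reg d j) (\<omega> j) \<and> 0 < f 0 (\<omega> j)"
      unfolding change_measure_def
      by (rule AE_PiM_component[where P="\<lambda>x. 0 < f (reg d j) x \<and> 0 < f 0 x"])
         (use True reg_range[OF True, of d] AE_densities_pos[of "reg d j"] regime_le prob_obs_law in auto)
    then show ?thesis by simp
  qed simp
qed

text \<open>\<open>C\<close> depends on \<eta> alone, neither on the durations nor on the index set:
  only L laws occur, so one truncation level makes all clipping errors less than \<eta> / 2.\<close>

lemma llr_sum_L1: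
  fixes \<eta> :: real
  assumes "0 < \<eta>"
  obtains C :: real where "0 \<le> C"
    and "\<And>d J. finite J \<Longrightarrow> J \<subseteq> {1..} \<Longrightarrow>
      (\<integral>\<omega>. \<bar>\<Sum>j\<in>J. llr (reg d j) (\<omega> j) - info (reg d j)\<bar> \<partial>P d 1) \<le> \<eta> * card J + C * sqrt (card J)"
proof -
  have "\<forall>i\<in>{1..L}. eventually (\<lambda>n. (\<integral>x. \<bar>llr i x - clip (real n) (llr i x)\<bar> \<partial>obs_law i) < \<eta> / 2) sequentially"
    using clip_error_tendsto[OF integrable_llr] assms by (auto intro!: order_tendstoD(2))
  then have "eventually (\<lambda>n. \<forall>i\<in>{1..L}. (\<integral>x. \<bar>llr i x - clip (real n) (llr i x)\<bar> \<partial>obs_law i) < \<eta> / 2) sequentially"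
    by (intro eventually_ball_finite) auto
  then obtain n where n: "\<And>i. i \<in> {1..L} \<Longrightarrow> (\<integral>x. \<bar>llr i x - clip (real n) (llr i x)\<bar> \<partial>obs_law i) < \<eta> / 2"
    using eventually_happens'[OF sequentially_bot] by blast
  show ?thesis
  proof (rule that[of "2 * real n"])
    fix d and J :: "nat set"
    assume J: "finite J" "J \<subseteq> {1..}"
    interpret prob_space "P d 1" by (rule prob_P) simp
    have "indep_vars (\<lambda>_. borel) (\<lambda>j \<omega>. llr (reg d j) (\<omega> j)) J"
      using J reg_range
      by (intro indep_vars_compose2[OF indep_vars_subset[OF indep_coords]] llr_measurable) auto
    moreover have "expectation (\<lambda>\<omega>. \<bar>llr (reg d j) (\<omega> j) - clip (real n) (llr (reg d j) (\<omega> j))\<bar>) \<le> \<eta> / 2" if "j \<in> J" for j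
    proof -
      have j: "1 \<le> j" using that J by auto
      have "(\<lambda>x. \<bar>llr (reg d j) x - clip (real n) (llr (reg d j) x)\<bar>) \<in> borel_measurable \<mu>"
        using llr_measurable reg_range[OF j] by (intro borel_measurable_abs borel_measurable_diff measurable_compose[OF _ clip_measurable]) auto
      then show ?thesis
        using n[of "reg d j"] reg_range[OF j] by (subst integral_coord[OF j]) auto
    qed
    moreover have "expectation (\<lambda>\<omega>. llr (reg d j) (\<omega> j)) = info (reg d j)" if "j \<in> J" for j
      using that J reg_range[of j] llr_measurable integral_llr by (subst integral_coord) auto
    moreover have "integrable (P d 1) (\<lambda>\<omega>. llr (reg d j) (\<omega> j))" if "j \<in> J" for j
      using that J by (intro integrable_llr_coord) auto
    ultimately show "expectation (\<lambda>\<omega>. \<bar>\<Sum>j\<in>J. llr (reg d j) (\<omega> j) - info (reg d j)\<bar>) \<le> \<eta> * card J + 2 * real n * sqrt (card J)"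
      using expectation_abs_sum_centered_le[OF J(1), of "\<lambda>j \<omega>. llr (reg d j) (\<omega> j)" "real n" "\<eta> / 2"]
      by (simp cong: sum.cong)
  qed simp
qed

text \<open>Markov's inequality, where \<open>a\<close> is the amount by which the mean exceeds the
  threshold. The uniformity in \<open>d\<close> and \<open>J\<close> is inherited.\<close>

lemma llr_sum_tail:
  fixes \<eta> :: real
  assumes "0 < \<eta>"
  obtains C :: real where "0 \<le> C"
    and "\<And>d J t a. finite J \<Longrightarrow> J \<subseteq> {1..} \<Longrightarrow> 0 < a \<Longrightarrow> t + a \<le> (\<Sum>j\<in>J. info (reg d j)) \<Longrightarrow>
      measure (P d 1) {\<omega> \<in> space (P d 1). (\<Sum>j\<in>J. llr (reg d j) (\<omega> j)) < t}
        \<le> (\<eta> * card J + C * sqrt (card J)) / a"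
proof -
  obtain C where C: "0 \<le> C"
    and L1: "\<And>d J. finite J \<Longrightarrow> J \<subseteq> {1..} \<Longrightarrow>
      (\<integral>\<omega>. \<bar>\<Sum>j\<in>J. llr (reg d j) (\<omega> j) - info (reg d j)\<bar> \<partial>P d 1) \<le> \<eta> * card J + C * sqrt (card J)"
    using llr_sum_L1[OF assms] by blast
  show ?thesis
  proof (rule that[OF C])
    fix d and t a :: real and J :: "nat set"
    assume J: "finite J" "J \<subseteq> {1..}" and a: "0 < a" and ta: "t + a \<le> (\<Sum>j\<in>J. info (reg d j))"
    interpret prob_space "P d 1" by (rule prob_P) simp
    let ?S = "\<lambda>\<omega>. \<bar>\<Sum>j\<in>J. llr (reg d j) (\<omega> j) - info (reg d j)\<bar>"
    have int: "integrable (P d 1) ?S"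
      using J by (intro integrable_abs Bochner_Integration.integrable_sum Bochner_Integration.integrable_diff integrable_llr_coord integrable_const) auto
    then have S: "?S \<in> borel_measurable (P d 1)" by auto
    have "prob {\<omega> \<in> space (P d 1). (\<Sum>j\<in>J. llr (reg d j) (\<omega> j)) < t} \<le> prob {\<omega> \<in> space (P d 1). a \<le> ?S \<omega>}"
    proof (rule finite_measure_mono)
      show "{\<omega> \<in> space (P d 1). (\<Sum>j\<in>J. llr (reg d j) (\<omega> j)) < t} \<subseteq> {\<omega> \<in> space (P d 1). a \<le> ?S \<omega>}"
        using ta by (auto simp: sum_subtractf)
      show "{\<omega> \<in> space (P d 1). a \<le> ?S \<omega>} \<in> events"
        using S by measurable
    qed
    also have "\<dots> \<le> expectation ?S / a"
      using integral_Markov_inequality_measure[OF int, of "{}" a] a by simp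
    also have "\<dots> \<le> (\<eta> * card J + C * sqrt (card J)) / a"
      using L1[OF J] a by (intro divide_right_mono) auto
    finally show "prob {\<omega> \<in> space (P d 1). (\<Sum>j\<in>J. llr (reg d j) (\<omega> j)) < t} \<le> (\<eta> * card J + C * sqrt (card J)) / a" .
  qed
qed

end

section \<open>The block argument\<close>

text \<open>Beyond \<open>N\<close> the time axis is cut into blocks of length \<open>m\<close>;
  each block whose left end lies before \<open>t\<close> is counted in full.\<close>

lemma ennreal_of_enat_le_blocks:
  assumes "0 < m"
  shows "ennreal_of_enat t \<le> of_nat N + (\<Sum>q. of_nat m * (if enat (N + q * m) < t then 1 else 0 :: ennreal))"
proof -
  \<comment> \<open>Capping \<open>t\<close> at the end of block Q permits an induction that covers
    t = \<infinity> as well.\<close>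
  have part: "min t (enat (N + Q * m)) \<le> enat N + (\<Sum>q<Q. enat m * (if enat (N + q * m) < t then 1 else 0))" for Q
  proof (induction Q)
    case (Suc Q)
    show ?case
    proof (cases "enat (N + Q * m) < t")
      case True
      have "min t (enat (N + Suc Q * m)) \<le> enat (N + Q * m) + enat m"
        by (simp add: min.coboundedI2 add.commute add.left_commute)
      also have "enat (N + Q * m) = min t (enat (N + Q * m))"
        using True by (simp add: min_absorb2)
      also have "\<dots> + enat m \<le> (enat N + (\<Sum>q<Q. enat m * (if enat (N + q * m) < t then 1 else 0))) + enat m"
        by (intro add_right_mono Suc)
      finally show ?thesis using True by (simp add: add.assoc)
    next
      case False
      then have "min t (enat (N + Suc Q * m)) \<le> min t (enat (N + Q * m))"
        by (simp add: min_absorb1 not_less)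
      also have "\<dots> \<le> enat N + (\<Sum>q<Q. enat m * (if enat (N + q * m) < t then 1 else 0))"
        by (rule Suc)
      finally show ?thesis using False by simp
    qed
  qed simp
  have part': "ennreal_of_enat (min t (enat (N + Q * m)))
      \<le> of_nat N + (\<Sum>q. of_nat m * (if enat (N + q * m) < t then 1 else 0))" for Q
  proof -
    have "ennreal_of_enat (min t (enat (N + Q * m))) \<le>
        ennreal_of_enat (enat N + (\<Sum>q<Q. enat m * (if enat (N + q * m) < t then 1 else 0)))"
      using part by (simp only: ennreal_of_enat_le_iff)
    also have "\<dots> = of_nat N + (\<Sum>q<Q. ennreal_of_enat (enat m * (if enat (N + q * m) < t then 1 else 0)))"
      by (simp only: ennreal_of_enat_plus ennreal_of_enat_enat sum_ennreal_of_enat)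
    also have "\<dots> = of_nat N + (\<Sum>q<Q. of_nat m * (if enat (N + q * m) < t then 1 else 0))"
      by (intro arg_cong2[where f="(+)"] sum.cong refl) auto
    also have "\<dots> \<le> of_nat N + (\<Sum>q. of_nat m * (if enat (N + q * m) < t then 1 else 0))"
      by (intro add_left_mono sum_le_suminf) auto
    finally show ?thesis .
  qed
  show ?thesis
  proof (cases t)
    case (enat n)
    have "n * 1 \<le> n * m" using assms by (intro mult_left_mono) auto
    then have "min t (enat (N + n * m)) = t" unfolding enat by (intro min_absorb1) (simp del: mult_le_cancel1 add: trans_le_add2)
    then show ?thesis using part'[of n] by simp
  next
    case infinity
    have "of_nat Q \<le> of_nat N + (\<Sum>q. of_nat m * (if enat (N + q * m) < t then 1 else 0 :: ennreal))" for Q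
    proof -
      have "Q * 1 \<le> Q * m" using assms by (intro mult_left_mono) auto
      then have "of_nat Q \<le> (of_nat (N + Q * m) :: ennreal)"
        by (intro of_nat_mono) linarith
      then have "of_nat Q \<le> ennreal_of_enat (min t (enat (N + Q * m)))"
        by (simp add: infinity)
      then show ?thesis using part'[of Q] by (rule order_trans)
    qed
    then have "of_nat N + (\<Sum>q. of_nat m * (if enat (N + q * m) < t then 1 else 0 :: ennreal)) = \<infinity>"
      using ennreal_Ex_less_of_nat by (metis infinity_ennreal_def leD less_top)
    then show ?thesis by simp
  qed
qed

context kl_model
begin

text \<open>An upper bound for minus the logarithm of the penalty factor after \<open>n\<close> observations.\<close>

definition penalty :: "(nat \<Rightarrow> real) \<Rightarrow> nat \<Rightarrow> real" where
  "penalty \<rho> n = (\<Sum>i=1..<L. - ln (\<rho> i)) + real n * (\<Sum>i=1..<L. - ln (1 - \<rho> i))"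

text \<open>The statistic is evaluated at the true change-points, moved into the block \<open>{s..k}\<close>.\<close>

lemma wdcusum_stat_ge_block:
  assumes \<rho>: "\<And>i. 1 \<le> i \<Longrightarrow> i < L \<Longrightarrow> 0 < \<rho> i \<and> \<rho> i < 1"
    and s: "1 \<le> s" "s \<le> Suc k"
    and pos: "\<forall>j\<ge>1. 0 < f (reg d j) (\<omega> j) \<and> 0 < f 0 (\<omega> j)"
    and ge: "b + penalty \<rho> (Suc k - s) \<le> (\<Sum>j=s..<Suc k. llr (reg d j) (\<omega> j))"
  shows "ereal b \<le> wdcusum_stat f L \<rho> k \<omega>"
proof -
  \<comment> \<open>The true change-points are clamped to the range from s to k + 1. Regimes that
    end before the block or start after it get empty segments, and on every nonempty segment the
    assigned regime is the true one.\<close>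
  define v where "v = (\<lambda>i\<in>{1..L}. max s (min (k + 1) (1 + (\<Sum>j=1..<i. d j))))"
  define w where "w = (\<lambda>i. if i \<le> L then v i else k + 1)"
  define r where "r = \<rho>(L := 0)"
  define q where "q i = (1 - r i) ^ (w (Suc i) - w i) * r i ^ (if w (Suc i) \<le> k then 1 else 0)" for i
  have L1: "1 \<le> L" using L2 by simp
  have cmono: "(\<Sum>l=1..<i. d l) \<le> (\<Sum>l=1..<j. d l)" if "i \<le> j" for i j
    using that by (intro sum_mono2) auto
  have v: "v \<in> wd_points L k"
    using s cmono by (auto simp: wd_points_def v_def mono_on_def min_def max_def le_diff_conv
        intro: order_trans)
  have w1: "w 1 = s" "w (Suc L) = Suc k"
    using L1 s by (auto simp: w_def v_def)
  have w_mono: "w i \<le> w (Suc i)" if "i \<in> {1..L}" for i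
    using that wd_points_mono[OF v, of i "Suc i"] wd_points_range[OF v, of i] by (auto simp: w_def)
  have w_range: "s \<le> w i \<and> w i \<le> Suc k" if "i \<in> {1..Suc L}" for i
    using that wd_points_range[OF v, of i] s by (auto simp: w_def v_def)
  have reg: "reg d j = i" if i: "i \<in> {1..L}" and j: "j \<in> {w i..<w (Suc i)}" for i j
  proof (rule regime_eqI)
    have jk: "j < Suc k" "s \<le> j"
      using j w_range[of "Suc i"] w_range[of i] i by auto
    show "change_point L d 1 i \<le> enat j"
      using i j jk by (auto simp: change_point_def w_def v_def)
    show "enat j < change_point L d 1 (Suc i)"
      using i j jk by (auto simp: change_point_def w_def v_def split: if_splits)
  qed (use i in auto)
  have "(\<Prod>i=1..L. \<Prod>j=w i..<w (Suc i). f i (\<omega> j) / f 0 (\<omega> j))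
      = (\<Prod>i=1..L. \<Prod>j=w i..<w (Suc i). f (reg d j) (\<omega> j) / f 0 (\<omega> j))"
    by (intro prod.cong refl) (simp add: reg del: One_nat_def)
  also have "\<dots> = (\<Prod>j=s..<Suc k. f (reg d j) (\<omega> j) / f 0 (\<omega> j))"
    by (subst prod_concat[of L w, OF w_mono]) (auto simp: w1[unfolded One_nat_def])
  finally have lik: "(\<Prod>i=1..L. \<Prod>j=w i..<w (Suc i). f i (\<omega> j) / f 0 (\<omega> j))
      = (\<Prod>j=s..<Suc k. f (reg d j) (\<omega> j) / f 0 (\<omega> j))" .
  have ratio: "wd_ratio f L \<rho> k v \<omega> = (\<Prod>j=s..<Suc k. f (reg d j) (\<omega> j) / f 0 (\<omega> j)) * (\<Prod>i=1..L. q i)"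
    unfolding lik[symmetric] wd_ratio_split[OF v L1] w_def q_def r_def ..
  have fpos: "0 < f (reg d j) (\<omega> j) / f 0 (\<omega> j)" if "j \<in> {s..<Suc k}" for j
    using that s pos by auto
  have ln_lik: "ln (\<Prod>j=s..<Suc k. f (reg d j) (\<omega> j) / f 0 (\<omega> j)) = (\<Sum>j=s..<Suc k. llr (reg d j) (\<omega> j))"
    unfolding llr_def using fpos by (intro ln_prod) force+
  \<comment> \<open>The last segment ends at k + 1, so its weight has exponent 0. This is why
    \<open>penalty\<close> sums over i < L only.\<close>
  have qL: "q L = 1" using w1 by (simp add: q_def r_def)
  have q: "0 < q i \<and> ln (\<rho> i) + real (Suc k - s) * ln (1 - \<rho> i) \<le> ln (q i)" if i: "i \<in> {1..<L}" for i
  proof -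
    have ri: "r i = \<rho> i" "0 < \<rho> i" "\<rho> i < 1" using \<rho>[of i] i by (auto simp: r_def)
    define e :: nat where "e = (if w (Suc i) \<le> k then 1 else 0)"
    have "ln (q i) = real (w (Suc i) - w i) * ln (1 - \<rho> i) + real e * ln (\<rho> i)"
      using ri by (simp add: q_def e_def ln_mult ln_realpow)
    moreover have "real (Suc k - s) * ln (1 - \<rho> i) \<le> real (w (Suc i) - w i) * ln (1 - \<rho> i)"
      using ri w_range[of i] w_range[of "Suc i"] i by (intro mult_right_mono_neg) auto
    moreover have "1 * ln (\<rho> i) \<le> real e * ln (\<rho> i)"
      using ri by (intro mult_right_mono_neg) (auto simp: e_def)
    ultimately have "ln (\<rho> i) + real (Suc k - s) * ln (1 - \<rho> i) \<le> ln (q i)" by linarith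
    then show ?thesis using ri by (simp add: q_def)
  qed
  have split: "(\<Prod>i=1..L. q i) = (\<Prod>i=1..<L. q i)"
    using L1 qL by (simp add: prod.last_plus atLeastLessThanSuc_atLeastAtMost[symmetric])
  have "ln (\<Prod>i=1..<L. q i) = (\<Sum>i=1..<L. ln (q i))"
    using q by (intro ln_prod) force+
  also have "\<dots> \<ge> (\<Sum>i=1..<L. ln (\<rho> i) + real (Suc k - s) * ln (1 - \<rho> i))"
    using q by (intro sum_mono) auto
  finally have ln_q: "- penalty \<rho> (Suc k - s) \<le> ln (\<Prod>i=1..<L. q i)"
    by (simp add: penalty_def sum.distrib sum_distrib_left sum_negf)
  have pos': "0 < (\<Prod>j=s..<Suc k. f (reg d j) (\<omega> j) / f 0 (\<omega> j))" "0 < (\<Prod>i=1..<L. q i)"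
    using fpos q by (auto intro!: prod_pos simp del: prod.op_ivl_Suc)
  then have "b \<le> ln (wd_ratio f L \<rho> k v \<omega>)"
    unfolding ratio split using ge ln_q ln_lik ln_mult_pos[OF pos'] by linarith
  moreover have "wd_ratio f L \<rho> k v \<omega> \<noteq> 0"
    unfolding ratio split using mult_pos_pos[OF pos'] by (metis less_irrefl)
  ultimately show ?thesis
    unfolding wdcusum_stat_ge_iff elog_ge_iff using v by blast
qed

text \<open>A first block of length \<open>N\<close> and further blocks of length \<open>m\<close>: the stopping time exceeds the end
  of a block only if the sums of the log-likelihood ratios over all blocks so far are too small,
  and these sums are independent.\<close>

lemma mean_delay_le_blocks:
  assumes \<rho>: "\<And>i. 1 \<le> i \<Longrightarrow> i < L \<Longrightarrow> 0 < \<rho> i \<and> \<rho> i < 1"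
    and N: "0 < N" and m: "0 < m" and \<theta>: "0 \<le> \<theta>"
    and first: "measure (P d 1) {\<omega> \<in> space (P d 1). (\<Sum>j=1..<Suc N. llr (reg d j) (\<omega> j)) < b + penalty \<rho> N} \<le> \<theta>"
    and later: "\<And>s. 1 \<le> s \<Longrightarrow>
      measure (P d 1) {\<omega> \<in> space (P d 1). (\<Sum>j=s..<s + m. llr (reg d j) (\<omega> j)) < b + penalty \<rho> m} \<le> 1 / 2"
  shows "(\<integral>\<^sup>+\<omega>. ennreal_of_enat (wdcusum_time f L \<rho> b \<omega> - 1) \<partial>P d 1) \<le> ennreal (real N + 2 * real m * \<theta>)"
proof -
  interpret W: suffix_rule_model \<mu> f L "\<lambda>k X. ereal b \<le> wdcusum_stat f L \<rho> k X"
    by (rule wdcusum_rule)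
  have time: "wdcusum_time f L \<rho> b = W.rule_time"
    by (simp add: fun_eq_iff wdcusum_time_def W.rule_time_def)
  interpret prob_space "P d 1" by (rule prob_P) simp
  \<comment> \<open>Block 0 ends at N and block q + 1 at N + (q + 1) m, so block p always ends at N
    + p m.\<close>
  define B where "B p = (case p of 0 \<Rightarrow> {1..<Suc N} | Suc q \<Rightarrow> {Suc (N + q * m)..<Suc (N + q * m) + m})" for p
  define t where "t p = (case p of 0 \<Rightarrow> b + penalty \<rho> N | Suc q \<Rightarrow> b + penalty \<rho> m)" for p :: nat
  define S where "S p \<omega> = (\<Sum>j\<in>B p. llr (reg d j) (\<omega> j))" for p \<omega>
  have B_sub: "B p \<subseteq> {1..}" for p by (auto simp: B_def split: nat.splits)
  have disj: "B p \<inter> B q = {}" if pq: "p < q" for p q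
  proof -
    obtain q' where q': "q = Suc q'" using less_imp_Suc_add[OF pq] by blast
    have ivl: "{a..<b} \<inter> {c..<e} = {}" if "b \<le> c" for a b c e :: nat
      using that by auto
    show ?thesis
    proof (cases p)
      case 0
      show ?thesis unfolding B_def q' 0 nat.case by (rule ivl) simp
    next
      case (Suc p')
      have "Suc p' * m \<le> q' * m" using pq Suc q' by (intro mult_right_mono) auto
      then show ?thesis unfolding B_def q' Suc nat.case by (intro ivl) simp
    qed
  qed
  then have disj: "disjoint_family_on B UNIV"
    unfolding disjoint_family_on_def by (metis Int_commute linorder_neqE_nat)
  have "indep_vars (\<lambda>_. borel) (\<lambda>p \<omega>. \<Sum>j\<in>B p. llr (reg d j) (restrict \<omega> (B p) j)) UNIV"
  proof (rule indep_vars_compose2[OF indep_vars_restrict[OF indep_coords _ disj]])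
    show "(\<lambda>\<omega>. \<Sum>j\<in>B p. llr (reg d j) (\<omega> j)) \<in> borel_measurable (PiM (B p) (\<lambda>_. \<mu>))" for p
      using reg_range B_sub
      by (intro borel_measurable_sum measurable_compose[OF measurable_component_singleton, where g="llr _"] llr_measurable) auto
  qed (use B_sub in auto)
  then have ind: "indep_vars (\<lambda>_. borel) S UNIV"
    unfolding S_def[abs_def] by simp
  have fail: "prob (S p -` {..<t p} \<inter> space (P d 1)) \<le> (if p = 0 then \<theta> else 1 / 2)" for p
  proof (cases p)
    case 0
    then show ?thesis using first by (simp add: S_def B_def t_def vimage_def Int_def conj_commute)
  next
    case (Suc q)
    then show ?thesis using later[of "Suc (N + q * m)"]
      by (simp add: S_def B_def t_def vimage_def Int_def conj_commute)
  qed
  \<comment> \<open>The factor \<theta> of block 0 is present for every q; summing the geometric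
    series then costs only 2 m \<theta> beyond N.\<close>
  have all_fail: "prob (\<Inter>p\<in>{..q}. S p -` {..<t p} \<inter> space (P d 1)) \<le> \<theta> * (1 / 2) ^ q" for q
  proof -
    have "prob (\<Inter>p\<in>{..q}. S p -` {..<t p} \<inter> space (P d 1)) = (\<Prod>p\<le>q. prob (S p -` {..<t p} \<inter> space (P d 1)))"
      by (rule indep_varsD[OF ind]) auto
    also have "\<dots> \<le> (\<Prod>p\<le>q. if p = 0 then \<theta> else 1 / 2)"
      by (intro prod_mono conjI measure_nonneg fail)
    also have "\<dots> = \<theta> * (1 / 2) ^ q" by (subst prod.atMost_shift) simp
    finally show ?thesis .
  qed
  have incl: "AE \<omega> in P d 1. enat (N + q * m) < W.rule_time \<omega>
      \<longrightarrow> \<omega> \<in> (\<Inter>p\<in>{..q}. S p -` {..<t p} \<inter> space (P d 1))" for q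
    using AE_coord_densities_pos[of d] AE_space
  proof eventually_elim
    case (elim \<omega>)
    show ?case
    proof (intro impI INT_I)
      fix p assume late: "enat (N + q * m) < W.rule_time \<omega>" and p: "p \<in> {..q}"
      \<comment> \<open>At the end of block p the statistic is bounded below through that block
        alone. Ignoring the earlier observations is what makes the failure events
        independent.\<close>
      define k where "k = N + p * m"
      define s where "s = (case p of 0 \<Rightarrow> 1 | Suc q \<Rightarrow> Suc (N + q * m))"
      have "k \<le> N + q * m" using p by (simp add: k_def)
      then have "enat k < W.rule_time \<omega>"
        using late by (intro order_le_less_trans[OF _ late]) simp
      then have "\<not> ereal b \<le> wdcusum_stat f L \<rho> k \<omega>"
        using W.rule_time_le[of k \<omega>] N by (auto simp: k_def)
      moreover have Bs: "B p = {s..<Suc k}" "t p = b + penalty \<rho> (Suc k - s)" "1 \<le> s" "s \<le> Suc k"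
        by (auto simp: B_def t_def s_def k_def split: nat.splits)
      ultimately have "S p \<omega> < t p"
        using wdcusum_stat_ge_block[OF \<rho> Bs(3,4) elim(1), where b=b] unfolding S_def Bs(1,2)
        by (meson not_le)
      then show "\<omega> \<in> S p -` {..<t p} \<inter> space (P d 1)" using elim by simp
    qed
  qed
  have meas: "{\<omega> \<in> space (P d 1). enat n < W.rule_time \<omega>} \<in> events" for n
  proof -
    have [measurable]: "W.rule_time \<in> P d 1 \<rightarrow>\<^sub>M count_space UNIV"
      using W.measurable_rule_time by (subst measurable_cong_sets[OF sets_change_measure refl])
    show ?thesis by measurable
  qed
  have tail: "emeasure (P d 1) {\<omega> \<in> space (P d 1). enat (N + q * m) < W.rule_time \<omega>} \<le> ennreal (\<theta> * (1 / 2) ^ q)" for q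
  proof -
    have S_meas: "S p \<in> borel_measurable (P d 1)" for p
      using ind unfolding indep_vars_def by blast
    have "emeasure (P d 1) {\<omega> \<in> space (P d 1). enat (N + q * m) < W.rule_time \<omega>}
        \<le> emeasure (P d 1) (\<Inter>p\<in>{..q}. S p -` {..<t p} \<inter> space (P d 1))"
      by (rule emeasure_mono_AE)
         (use incl[of q] S_meas in \<open>auto intro!: sets.finite_INT measurable_sets\<close>)
    also have "\<dots> \<le> ennreal (\<theta> * (1 / 2) ^ q)"
      unfolding emeasure_eq_measure by (rule ennreal_leI[OF all_fail])
    finally show ?thesis .
  qed
  have "(\<integral>\<^sup>+\<omega>. ennreal_of_enat (W.rule_time \<omega> - 1) \<partial>P d 1)
      \<le> (\<integral>\<^sup>+\<omega>. of_nat N + (\<Sum>q. of_nat m * indicator {\<omega> \<in> space (P d 1). enat (N + q * m) < W.rule_time \<omega>} \<omega>) \<partial>P d 1)"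
  proof (rule nn_integral_mono)
    fix \<omega> assume \<omega>: "\<omega> \<in> space (P d 1)"
    have "W.rule_time \<omega> - 1 \<le> W.rule_time \<omega>" by (cases "W.rule_time \<omega>") (auto simp: one_enat_def)
    then have "ennreal_of_enat (W.rule_time \<omega> - 1) \<le> ennreal_of_enat (W.rule_time \<omega>)" by simp
    also note ennreal_of_enat_le_blocks[OF m, of "W.rule_time \<omega>" N]
    also have "(\<lambda>q. of_nat m * (if enat (N + q * m) < W.rule_time \<omega> then 1 else 0 :: ennreal))
        = (\<lambda>q. of_nat m * indicator {\<omega> \<in> space (P d 1). enat (N + q * m) < W.rule_time \<omega>} \<omega>)"
      using \<omega> by (auto simp: indicator_def)
    finally show "ennreal_of_enat (W.rule_time \<omega> - 1)
      \<le> of_nat N + (\<Sum>q. of_nat m * indicator {\<omega> \<in> space (P d 1). enat (N + q * m) < W.rule_time \<omega>} \<omega>)" .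
  qed
  also have "\<dots> = of_nat N + (\<Sum>q. of_nat m * emeasure (P d 1) {\<omega> \<in> space (P d 1). enat (N + q * m) < W.rule_time \<omega>})"
    using meas by (simp add: nn_integral_add nn_integral_suminf nn_integral_cmult emeasure_space_1 del: One_nat_def)
  also have "\<dots> \<le> of_nat N + (\<Sum>q. of_nat m * ennreal (\<theta> * (1 / 2) ^ q))"
    by (intro add_left_mono suminf_le mult_left_mono tail) auto
  also have "(\<Sum>q. of_nat m * ennreal (\<theta> * (1 / 2) ^ q)) = (\<Sum>q. ennreal (real m * \<theta> * (1 / 2) ^ q))"
    using \<theta> by (simp add: ennreal_mult ennreal_of_nat_eq_real_of_nat mult.assoc)
  also have "\<dots> = ennreal (real m * \<theta> * 2)"
    using \<theta> geometric_sums[of "1 / 2 :: real"]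
    by (intro suminf_ennreal_eq sums_mult[of _ 2, simplified]) auto
  also have "of_nat N + ennreal (real m * \<theta> * 2) = ennreal (real N + 2 * real m * \<theta>)"
    using \<theta> by (simp add: ennreal_plus ennreal_of_nat_eq_real_of_nat algebra_simps)
  finally show ?thesis unfolding time .
qed

end

section \<open>Asymptotics of the delay\<close>

lemma divide_sqrt_eventually_le:
  fixes A e :: real
  assumes "0 < e"
  shows "\<forall>\<^sub>F b in at_top. A / sqrt b \<le> e"
proof -
  have "((\<lambda>b. A / sqrt b) \<longlongrightarrow> 0) at_top"
    by (intro real_tendsto_divide_at_top[OF tendsto_const] sqrt_at_top)
  from order_tendstoD(2)[OF this assms] show ?thesis
    by eventually_elim simp
qed

context kl_model
begin

lemma info_sum_full_regimes:
  assumes "1 \<le> h" "h \<le> L"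
  shows "(\<Sum>j=1..<Suc (\<Sum>i=1..<h. d i). info (reg d j)) = (\<Sum>i=1..<h. real (d i) * info i)"
  using assms
proof (induction h rule: dec_induct)
  case (step h)
  let ?a = "\<Sum>i=1..<h. d i"
  have reg: "reg d j = h" if "j \<in> {Suc ?a..<Suc ?a + d h}" for j
    using that step by (intro regime_eqI) (auto simp: change_point_def)
  have "(\<Sum>j=1..<Suc (\<Sum>i=1..<Suc h. d i). info (reg d j)) = (\<Sum>j=1..<Suc ?a + d h. info (reg d j))"
    using step by simp
  also have "\<dots> = (\<Sum>j=1..<Suc ?a. info (reg d j)) + (\<Sum>j=Suc ?a..<Suc ?a + d h. info (reg d j))"
    by (rule sum.atLeastLessThan_concat[symmetric]) auto
  also have "(\<Sum>j=Suc ?a..<Suc ?a + d h. info (reg d j)) = (\<Sum>j=Suc ?a..<Suc ?a + d h. info h)"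
    by (intro sum.cong refl) (simp only: reg)
  finally show ?case using step by simp
qed simp

text \<open>Full regimes before h, then n observations of regime h, then a remainder credited only
  with the minimal rate \<open>I0\<close>. For h = L the regime never ends, so n is not limited by a
  duration.\<close>

lemma info_sum_ge:
  assumes h: "1 \<le> h" "h \<le> L" and n: "h < L \<Longrightarrow> n \<le> d h"
    and N: "(\<Sum>i=1..<h. d i) + n \<le> N" and I0: "\<And>i. 1 \<le> i \<Longrightarrow> i \<le> L \<Longrightarrow> I0 \<le> info i"
  shows "(\<Sum>i=1..<h. real (d i) * info i) + real n * info h + (real N - (\<Sum>i=1..<h. real (d i)) - real n) * I0
         \<le> (\<Sum>j=1..<Suc N. info (reg d j))"
proof -
  let ?a = "\<Sum>i=1..<h. d i"
  have reg: "reg d j = h" if "j \<in> {Suc ?a..<Suc ?a + n}" for j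
    using that h n by (intro regime_eqI) (auto simp: change_point_def)
  have "(\<Sum>j=1..<Suc N. info (reg d j)) = (\<Sum>j=1..<Suc ?a + n. info (reg d j)) + (\<Sum>j=Suc ?a + n..<Suc N. info (reg d j))"
    using N by (intro sum.atLeastLessThan_concat[symmetric]) auto
  also have "(\<Sum>j=1..<Suc ?a + n. info (reg d j)) = (\<Sum>j=1..<Suc ?a. info (reg d j)) + (\<Sum>j=Suc ?a..<Suc ?a + n. info (reg d j))"
    by (rule sum.atLeastLessThan_concat[symmetric]) auto
  also have "(\<Sum>j=Suc ?a..<Suc ?a + n. info (reg d j)) = (\<Sum>j=Suc ?a..<Suc ?a + n. info h)"
    by (intro sum.cong refl) (simp only: reg)
  also have "(\<Sum>j=1..<Suc ?a. info (reg d j)) = (\<Sum>i=1..<h. real (d i) * info i)"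
    by (rule info_sum_full_regimes[OF h])
  finally have eq: "(\<Sum>j=1..<Suc N. info (reg d j)) = (\<Sum>i=1..<h. real (d i) * info i) + real n * info h
      + (\<Sum>j=Suc ?a + n..<Suc N. info (reg d j))" by simp
  have "(\<Sum>j=Suc ?a + n..<Suc N. I0) \<le> (\<Sum>j=Suc ?a + n..<Suc N. info (reg d j))"
    using reg_range by (intro sum_mono I0) auto
  moreover have "(\<Sum>j=Suc ?a + n..<Suc N. I0) = (real N - (\<Sum>i=1..<h. real (d i)) - real n) * I0"
    using N by (simp add: of_nat_diff)
  ultimately show ?thesis unfolding eq by linarith
qed

lemma info_lower_bound:
  obtains I0 where "0 < I0" "\<And>i. 1 \<le> i \<Longrightarrow> i \<le> L \<Longrightarrow> I0 \<le> info i"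
proof (rule that[of "Min (info ` {1..L})"])
  show "0 < Min (info ` {1..L})" using L2 info_pos by (subst Min_gr_iff) auto
qed (auto intro: Min_le)

text \<open>C b observations supply mean information b up to o(b), and the further \<delta> b
  observations supply at least \<delta> I0 b. Half of that surplus pays for the errors, the other
  half is 2 \<kappa> b. For regime h only a lower bound is assumed, since its share may be infinite
  or exceed what is missing.\<close>

lemma info_sum_eventually:
  fixes d :: "real \<Rightarrow> nat \<Rightarrow> nat" and c :: "nat \<Rightarrow> real"
  assumes h: "1 \<le> h" "h \<le> L"
    and lim: "\<And>i. 1 \<le> i \<Longrightarrow> i < h \<Longrightarrow> ((\<lambda>b. real (d b i) * info i / b) \<longlongrightarrow> c i) at_top"
    and s: "(\<Sum>i=1..<h. c i) \<le> 1"
    and lim_h: "\<And>\<eta>. h < L \<Longrightarrow> 0 < \<eta> \<Longrightarrow> \<forall>\<^sub>F b in at_top. 1 - (\<Sum>i=1..<h. c i) - \<eta> \<le> real (d b h) * info h / b"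
    and \<delta>: "0 < \<delta>"
  defines "C \<equiv> (\<Sum>i=1..<h. c i / info i) + (1 - (\<Sum>i=1..<h. c i)) / info h"
  obtains \<kappa> where "0 < \<kappa>"
    "\<forall>\<^sub>F b in at_top. (1 + 2 * \<kappa>) * b \<le> (\<Sum>j=1..<Suc (nat \<lceil>(C + \<delta>) * b\<rceil>). info (reg (d b) j))"
proof -
  obtain I0 where I0: "0 < I0" "\<And>i. 1 \<le> i \<Longrightarrow> i \<le> L \<Longrightarrow> I0 \<le> info i"
    using info_lower_bound by blast
  define s' where "s' = (\<Sum>i=1..<h. c i)"
  \<comment> \<open>The total error is 2 \<eta> + 2 \<eta> I0 per unit of b; this choice keeps it
    below \<delta> I0 / 2.\<close>
  define \<eta> where "\<eta> = \<delta> * I0 / (4 * (2 + I0))"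
  have \<eta>: "0 < \<eta>" using \<delta> I0(1) by (simp add: \<eta>_def)
  have "4 * (2 + I0) \<noteq> 0" using I0(1) by simp
  from nonzero_eq_divide_eq[THEN iffD1, OF this \<eta>_def]
  have \<eta>_eq: "\<eta> * (2 + I0) * 4 = \<delta> * I0" by (simp add: mult_ac)
  have \<eta>\<delta>: "\<eta> \<le> \<delta> / 4"
    using I0(1) \<delta> by (simp add: \<eta>_def field_simps)
  have Ih: "0 < info h" using h info_pos by simp
  have "((\<lambda>b. \<Sum>i=1..<h. real (d b i) * info i / b) \<longlongrightarrow> s') at_top"
    unfolding s'_def by (intro tendsto_sum lim) auto
  then have ev1: "\<forall>\<^sub>F b in at_top. s' - \<eta> < (\<Sum>i=1..<h. real (d b i) * info i / b)"
    using \<eta> by (intro order_tendstoD(1)) auto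
  have "((\<lambda>b. \<Sum>i=1..<h. real (d b i) / b) \<longlongrightarrow> (\<Sum>i=1..<h. c i / info i)) at_top"
  proof (intro tendsto_sum)
    fix i assume i: "i \<in> {1..<h}"
    then have "info i \<noteq> 0" using info_pos[of i] h by auto
    with tendsto_divide[OF lim tendsto_const, of i "info i"] i
    show "((\<lambda>b. real (d b i) / b) \<longlongrightarrow> c i / info i) at_top" by simp
  qed
  then have ev2: "\<forall>\<^sub>F b in at_top. (\<Sum>i=1..<h. real (d b i) / b) < (\<Sum>i=1..<h. c i / info i) + \<eta>"
    using \<eta> by (intro order_tendstoD(2)) auto
  have ev3: "\<forall>\<^sub>F b in at_top. h < L \<longrightarrow> 1 - s' - \<eta> \<le> real (d b h) * info h / b"
    using lim_h[OF _ \<eta>] unfolding s'_def by (cases "h < L") auto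
  show ?thesis
  proof (rule that[of "\<delta> * I0 / 4"])
    show "0 < \<delta> * I0 / 4" using \<delta> I0(1) by simp
    show "\<forall>\<^sub>F b in at_top. (1 + 2 * (\<delta> * I0 / 4)) * b
        \<le> (\<Sum>j=1..<Suc (nat \<lceil>(C + \<delta>) * b\<rceil>). info (reg (d b) j))"
      using ev1 ev2 ev3 eventually_ge_at_top[of "1 / \<eta>"] eventually_gt_at_top[of 0]
    proof eventually_elim
      case (elim b)
      define x where "x = (1 - s') * b / info h"
      \<comment> \<open>About \<open>x\<close> observations of regime h supply the missing share 1 -
        s'. The duration caps them, and may fall short of \<open>x\<close> by a small multiple of b
        when the shares sum to exactly 1.\<close>
      define n where "n = (if h < L then min (d b h) (nat \<lceil>x\<rceil>) else nat \<lceil>x\<rceil>)"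
      define A where "A = (\<Sum>i=1..<h. real (d b i))"
      define N where "N = nat \<lceil>(C + \<delta>) * b\<rceil>"
      have x0: "0 \<le> x" unfolding x_def using elim s Ih by (auto simp: s'_def)
      have b: "0 < b" "1 \<le> \<eta> * b" using elim \<eta> by (auto simp: field_simps)
      have "real n \<le> real (nat \<lceil>x\<rceil>)" by (auto simp: n_def)
      also have "\<dots> \<le> x + 1" using x0 by linarith
      finally have n_le: "real n \<le> x + \<eta> * b" using b by linarith
      have n_ge: "(1 - s' - \<eta>) * b \<le> real n * info h"
      proof -
        have "x \<le> real (nat \<lceil>x\<rceil>)" by linarith
        then have "(1 - s') * b \<le> real (nat \<lceil>x\<rceil>) * info h"
          using Ih by (simp add: x_def divide_le_eq)
        moreover have "(1 - s' - \<eta>) * b \<le> (1 - s') * b" using b \<eta> by (intro mult_right_mono) auto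
        moreover have "(1 - s' - \<eta>) * b \<le> real (d b h) * info h" if "h < L"
          using elim(3) that b by (simp add: le_divide_eq)
        ultimately show ?thesis by (auto simp: n_def min_def)
      qed
      have A_le: "A \<le> ((\<Sum>i=1..<h. c i / info i) + \<eta>) * b"
        using elim(2) b by (simp add: A_def sum_divide_distrib[symmetric] divide_less_eq)
      have Cb: "C * b = (\<Sum>i=1..<h. c i / info i) * b + x"
        by (simp add: C_def x_def s'_def distrib_right)
      have N_ge: "(C + \<delta>) * b \<le> real N" unfolding N_def by linarith
      have slack: "(\<delta> - 2 * \<eta>) * b \<le> real N - A - real n"
        using N_ge A_le n_le Cb by (simp add: algebra_simps)
      moreover have "0 \<le> (\<delta> - 2 * \<eta>) * b" using \<eta>\<delta> b \<delta> by simp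
      ultimately have "A + real n \<le> real N" by linarith
      then have "real ((\<Sum>i=1..<h. d b i) + n) \<le> real N" by (simp add: A_def)
      then have fit: "(\<Sum>i=1..<h. d b i) + n \<le> N" by (simp only: of_nat_le_iff)
      have full: "(s' - \<eta>) * b \<le> (\<Sum>i=1..<h. real (d b i) * info i)"
        using elim(1) b by (simp add: sum_divide_distrib[symmetric] less_divide_eq)
      have rest: "(\<delta> - 2 * \<eta>) * b * I0 \<le> (real N - A - real n) * I0"
        using slack I0(1) by (intro mult_right_mono) auto
      have "1 + 2 * (\<delta> * I0 / 4) \<le> (s' - \<eta>) + (1 - s' - \<eta>) + (\<delta> - 2 * \<eta>) * I0"
        using \<eta>_eq \<eta> by (simp add: algebra_simps)
      then have "(1 + 2 * (\<delta> * I0 / 4)) * b \<le> ((s' - \<eta>) + (1 - s' - \<eta>) + (\<delta> - 2 * \<eta>) * I0) * b"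
        using b by (intro mult_right_mono) auto
      also have "\<dots> = (s' - \<eta>) * b + (1 - s' - \<eta>) * b + (\<delta> - 2 * \<eta>) * b * I0"
        by (simp add: algebra_simps)
      also have "\<dots> \<le> (\<Sum>i=1..<h. real (d b i) * info i) + real n * info h + (real N - A - real n) * I0"
        using full n_ge rest by linarith
      also have "\<dots> \<le> (\<Sum>j=1..<Suc N. info (reg (d b) j))"
        unfolding A_def by (rule info_sum_ge[OF h _ fit I0(2)]) (auto simp: n_def)
      finally show ?case unfolding N_def .
    qed
  qed
qed

text \<open>Leaving regimes costs o(b) by the condition on -ln \<rho>_i, while staying costs at most
  K b times a quantity that vanishes with the weights. The bound is uniform over block lengths up to
  K b.\<close>

lemma penalty_eventually:
  fixes \<rho> :: "real \<Rightarrow> nat \<Rightarrow> real"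
  assumes range: "\<And>b i. 0 < b \<Longrightarrow> 1 \<le> i \<Longrightarrow> i < L \<Longrightarrow> 0 < \<rho> b i \<and> \<rho> b i < 1"
    and zero: "\<And>i. 1 \<le> i \<Longrightarrow> i < L \<Longrightarrow> ((\<lambda>b. \<rho> b i) \<longlongrightarrow> 0) at_top"
    and log: "\<And>i. 1 \<le> i \<Longrightarrow> i < L \<Longrightarrow> ((\<lambda>b. - ln (\<rho> b i) / b) \<longlongrightarrow> 0) at_top"
    and \<kappa>: "0 < \<kappa>"
  shows "\<forall>\<^sub>F b in at_top. \<forall>n. real n \<le> K * b \<longrightarrow> penalty (\<rho> b) n \<le> \<kappa> * b"
proof -
  have lim: "((\<lambda>b. (\<Sum>i=1..<L. - ln (\<rho> b i) / b) + K * (\<Sum>i=1..<L. - ln (1 - \<rho> b i)))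
      \<longlongrightarrow> (\<Sum>i=1..<L. 0) + K * (\<Sum>i=1..<L. - ln (1 - 0))) at_top"
    by (intro tendsto_add tendsto_mult tendsto_sum tendsto_minus tendsto_ln tendsto_diff tendsto_const log zero) auto
  have "\<forall>\<^sub>F b in at_top. (\<Sum>i=1..<L. - ln (\<rho> b i) / b) + K * (\<Sum>i=1..<L. - ln (1 - \<rho> b i)) < \<kappa>"
    by (rule order_tendstoD(2)[OF lim]) (use \<kappa> in simp)
  then show ?thesis
    using eventually_gt_at_top[of 0]
  proof eventually_elim
    case (elim b)
    show ?case
    proof (intro allI impI)
      fix n :: nat assume n: "real n \<le> K * b"
      have "0 \<le> (\<Sum>i=1..<L. - ln (1 - \<rho> b i))"
        using range[OF elim(2)] by (intro sum_nonneg) (auto intro!: ln_le_zero_iff[THEN iffD2] less_imp_le)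
      then have "penalty (\<rho> b) n \<le> (\<Sum>i=1..<L. - ln (\<rho> b i)) + (K * b) * (\<Sum>i=1..<L. - ln (1 - \<rho> b i))"
        unfolding penalty_def using n by (intro add_left_mono mult_right_mono)
      also have "(\<Sum>i=1..<L. - ln (\<rho> b i)) = (\<Sum>i=1..<L. - ln (\<rho> b i) / b) * b"
        unfolding sum_distrib_right using elim(2) by simp
      also have "\<dots> + K * b * (\<Sum>i=1..<L. - ln (1 - \<rho> b i))
          = ((\<Sum>i=1..<L. - ln (\<rho> b i) / b) + K * (\<Sum>i=1..<L. - ln (1 - \<rho> b i))) * b"
        unfolding distrib_right by simp
      also have "\<dots> \<le> \<kappa> * b" using elim by (intro mult_right_mono) auto
      finally show "penalty (\<rho> b) n \<le> \<kappa> * b" .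
    qed
  qed
qed

lemma mean_delay_eventually:
  fixes d :: "real \<Rightarrow> nat \<Rightarrow> nat" and c :: "nat \<Rightarrow> real" and \<rho> :: "real \<Rightarrow> nat \<Rightarrow> real"
  assumes h: "1 \<le> h" "h \<le> L"
    and lim: "\<And>i. 1 \<le> i \<Longrightarrow> i < h \<Longrightarrow> ((\<lambda>b. real (d b i) * info i / b) \<longlongrightarrow> c i) at_top"
    and c0: "\<And>i. 0 \<le> c i" and s: "(\<Sum>i=1..<h. c i) \<le> 1"
    and lim_h: "\<And>\<eta>. h < L \<Longrightarrow> 0 < \<eta> \<Longrightarrow> \<forall>\<^sub>F b in at_top. 1 - (\<Sum>i=1..<h. c i) - \<eta> \<le> real (d b h) * info h / b"
    and range: "\<And>b i. 0 < b \<Longrightarrow> 1 \<le> i \<Longrightarrow> i < L \<Longrightarrow> 0 < \<rho> b i \<and> \<rho> b i < 1"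
    and zero: "\<And>i. 1 \<le> i \<Longrightarrow> i < L \<Longrightarrow> ((\<lambda>b. \<rho> b i) \<longlongrightarrow> 0) at_top"
    and log: "\<And>i. 1 \<le> i \<Longrightarrow> i < L \<Longrightarrow> ((\<lambda>b. - ln (\<rho> b i) / b) \<longlongrightarrow> 0) at_top"
    and \<delta>: "0 < \<delta>"
  defines "C \<equiv> (\<Sum>i=1..<h. c i / info i) + (1 - (\<Sum>i=1..<h. c i)) / info h"
  shows "\<forall>\<^sub>F b in at_top. (\<integral>\<^sup>+\<omega>. ennreal_of_enat (wdcusum_time f L (\<rho> b) b \<omega> - 1) \<partial>P (d b) 1)
           \<le> ennreal ((C + \<delta>) * b)"
proof -
  obtain I0 where I0: "0 < I0" "\<And>i. 1 \<le> i \<Longrightarrow> i \<le> L \<Longrightarrow> I0 \<le> info i"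
    using info_lower_bound by blast
  \<comment> \<open>One third of the slack goes to the length of the first block, one to its
    rounding, one to the expected cost of all later blocks.\<close>
  define \<delta>' where "\<delta>' = \<delta> / 3"
  have \<delta>': "0 < \<delta>'" using \<delta> by (simp add: \<delta>'_def)
  have C0: "0 \<le> C"
    unfolding C_def using c0 s h info_pos
    by (intro add_nonneg_nonneg sum_nonneg divide_nonneg_nonneg) (auto intro: less_imp_le)
  \<comment> \<open>For b \<ge> 1 both block lengths, including rounding, are at most K b.\<close>
  define K where "K = C + \<delta>' + 1 + 3 / I0"
  have K: "1 \<le> K" using C0 \<delta>' I0(1) by (simp add: K_def)
  obtain \<kappa> where \<kappa>: "0 < \<kappa>" and info_ev:
    "\<forall>\<^sub>F b in at_top. (1 + 2 * \<kappa>) * b \<le> (\<Sum>j=1..<Suc (nat \<lceil>(C + \<delta>') * b\<rceil>). info (reg (d b) j))"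
    using info_sum_eventually[OF h lim s lim_h \<delta>'] unfolding C_def by blast
  \<comment> \<open>Chosen so that 2 m \<theta> \<le> \<delta>' b whenever m \<le> K b.\<close>
  define \<theta> where "\<theta> = \<delta>' / (2 * K)"
  have \<theta>: "0 < \<theta>" using \<delta>' K by (simp add: \<theta>_def)
  \<comment> \<open>The first entry makes the linear part of the tail bound at most \<theta> / 2 for
    the first block, the second makes it at most 1/4 for later blocks. The square-root part is of
    order 1 / sqrt b and gets the other halves for large b.\<close>
  define \<eta> where "\<eta> = min (\<kappa> * \<theta> / (2 * K)) (1 / (4 * K))"
  have \<eta>: "0 < \<eta>" using \<theta> K \<kappa> by (simp add: \<eta>_def)
  have \<eta>_le: "\<eta> * K \<le> \<kappa> * \<theta> / 2" "\<eta> * K \<le> 1 / 4"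
  proof -
    have "\<eta> * K \<le> \<kappa> * \<theta> / (2 * K) * K" "\<eta> * K \<le> 1 / (4 * K) * K"
      using K unfolding \<eta>_def by (intro mult_right_mono; simp)+
    then show "\<eta> * K \<le> \<kappa> * \<theta> / 2" "\<eta> * K \<le> 1 / 4" using K by auto
  qed
  obtain A where A: "0 \<le> A"
    and tail: "\<And>d J t a. finite J \<Longrightarrow> J \<subseteq> {1..} \<Longrightarrow> 0 < a \<Longrightarrow> t + a \<le> (\<Sum>j\<in>J. info (reg d j)) \<Longrightarrow>
      measure (P d 1) {\<omega> \<in> space (P d 1). (\<Sum>j\<in>J. llr (reg d j) (\<omega> j)) < t}
        \<le> (\<eta> * card J + A * sqrt (card J)) / a"
    using llr_sum_tail[OF \<eta>] by blast
  have tail_K: "(\<eta> * real n + A * sqrt (real n)) / (x * b) \<le> (\<eta> * K + A * sqrt K / sqrt b) / x"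
    if "0 < b" "0 < x" "real n \<le> K * b" for n x b
  proof -
    have "sqrt (real n) \<le> sqrt (K * b)" using that by simp
    then have "\<eta> * real n + A * sqrt (real n) \<le> \<eta> * (K * b) + A * sqrt (K * b)"
      using that \<eta> A by (intro add_mono mult_left_mono) auto
    also have "\<dots> = (\<eta> * K + A * sqrt K / sqrt b) * b"
      using that(1) by (simp add: real_sqrt_mult field_simps)
    finally have "(\<eta> * real n + A * sqrt (real n)) / (x * b) \<le> (\<eta> * K + A * sqrt K / sqrt b) * b / (x * b)"
      using that by (intro divide_right_mono) auto
    then show ?thesis using that by simp
  qed
  have pen: "\<forall>\<^sub>F b in at_top. \<forall>n. real n \<le> K * b \<longrightarrow> penalty (\<rho> b) n \<le> min \<kappa> 1 * b"
    by (rule penalty_eventually[of \<rho>]) (use range zero log \<kappa> in auto)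
  have "0 < min (\<kappa> * \<theta> / 2) (1 / 4)" using \<kappa> \<theta> by simp
  note sq = divide_sqrt_eventually_le[OF this, of "A * sqrt K"]
  show ?thesis
    using info_ev pen sq eventually_ge_at_top[of 1] eventually_ge_at_top[of "1 / \<delta>'"]
  proof eventually_elim
    case (elim b)
    have b: "1 \<le> b" "0 < b" "1 \<le> \<delta>' * b" using elim \<delta>' by (auto simp: field_simps)
    define N where "N = nat \<lceil>(C + \<delta>') * b\<rceil>"
    \<comment> \<open>Mean information 3 b per block: b for the threshold, b for the penalty, b as
      the surplus in Markov's inequality.\<close>
    define m where "m = nat \<lceil>3 * b / I0\<rceil>"
    have ceil: "0 < nat \<lceil>x\<rceil>" "real (nat \<lceil>x\<rceil>) \<le> x + 1" "x \<le> real (nat \<lceil>x\<rceil>)" if "0 < x" for x :: real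
      using that by linarith+
    have pos_b: "0 < (C + \<delta>') * b" "0 < 3 * b / I0" using C0 \<delta>' b I0(1) by auto
    then have pos: "0 < N" "0 < m" and le: "real N \<le> (C + \<delta>') * b + 1" "real m \<le> 3 * b / I0 + 1"
      and m_ge: "3 * b / I0 \<le> real m"
      unfolding N_def m_def by (simp_all only: ceil)
    have "(C + \<delta>') * b + 1 + 3 * b / I0 \<le> K * b"
      using b by (simp add: K_def algebra_simps)
    then have NK: "real N \<le> K * b" and mK: "real m \<le> K * b"
      using le b pos_b by linarith+
    have \<rho>: "0 < \<rho> b i \<and> \<rho> b i < 1" if "1 \<le> i" "i < L" for i
      using range[OF b(2) that] .
    have penN: "penalty (\<rho> b) N \<le> \<kappa> * b"
    proof -
      have "penalty (\<rho> b) N \<le> min \<kappa> 1 * b" using elim(2) NK by blast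
      also have "\<dots> \<le> \<kappa> * b" using b by (intro mult_right_mono) auto
      finally show ?thesis .
    qed
    have penm: "penalty (\<rho> b) m \<le> b"
    proof -
      have "penalty (\<rho> b) m \<le> min \<kappa> 1 * b" using elim(2) mK by blast
      also have "\<dots> \<le> 1 * b" using b by (intro mult_right_mono) auto
      finally show ?thesis by simp
    qed
    have first: "measure (P (d b) 1) {\<omega> \<in> space (P (d b) 1).
        (\<Sum>j=1..<Suc N. llr (reg (d b) j) (\<omega> j)) < b + penalty (\<rho> b) N} \<le> \<theta>"
    proof -
      have "measure (P (d b) 1) {\<omega> \<in> space (P (d b) 1).
          (\<Sum>j=1..<Suc N. llr (reg (d b) j) (\<omega> j)) < b + penalty (\<rho> b) N}
          \<le> (\<eta> * card {1..<Suc N} + A * sqrt (card {1..<Suc N})) / (\<kappa> * b)"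
      proof (rule tail)
        show "b + penalty (\<rho> b) N + \<kappa> * b \<le> (\<Sum>j=1..<Suc N. info (reg (d b) j))"
          using elim(1) penN by (simp add: N_def algebra_simps)
      qed (use \<kappa> b in auto)
      also have "\<dots> \<le> (\<eta> * K + A * sqrt K / sqrt b) / \<kappa>"
        using tail_K[OF b(2) \<kappa> NK] by simp
      also have "\<dots> \<le> (\<kappa> * \<theta> / 2 + \<kappa> * \<theta> / 2) / \<kappa>"
        using \<eta>_le elim(3) \<kappa> by (intro divide_right_mono add_mono) auto
      also have "\<dots> = \<theta>" using \<kappa> by simp
      finally show ?thesis .
    qed
    have later: "measure (P (d b) 1) {\<omega> \<in> space (P (d b) 1).
        (\<Sum>j=s..<s + m. llr (reg (d b) j) (\<omega> j)) < b + penalty (\<rho> b) m} \<le> 1 / 2" if s: "1 \<le> s" for s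
    proof -
      have "measure (P (d b) 1) {\<omega> \<in> space (P (d b) 1).
          (\<Sum>j=s..<s + m. llr (reg (d b) j) (\<omega> j)) < b + penalty (\<rho> b) m}
          \<le> (\<eta> * card {s..<s + m} + A * sqrt (card {s..<s + m})) / (1 * b)"
      proof (rule tail)
        have "b + penalty (\<rho> b) m + 1 * b \<le> real m * I0"
          using penm m_ge I0(1) by (simp add: divide_le_eq)
        also have "\<dots> = (\<Sum>j=s..<s + m. I0)" by simp
        also have "\<dots> \<le> (\<Sum>j=s..<s + m. info (reg (d b) j))"
          using reg_range s by (intro sum_mono I0) auto
        finally show "b + penalty (\<rho> b) m + 1 * b \<le> (\<Sum>j=s..<s + m. info (reg (d b) j))" .
      qed (use b s in auto)
      also have "\<dots> \<le> (\<eta> * K + A * sqrt K / sqrt b) / 1"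
        using tail_K[OF b(2) zero_less_one mK] by simp
      also have "\<dots> \<le> (1 / 4 + 1 / 4) / 1"
        using \<eta>_le elim(3) by (intro divide_right_mono add_mono) auto
      also have "\<dots> = 1 / 2" by simp
      finally show ?thesis .
    qed
    have "(\<integral>\<^sup>+\<omega>. ennreal_of_enat (wdcusum_time f L (\<rho> b) b \<omega> - 1) \<partial>P (d b) 1)
        \<le> ennreal (real N + 2 * real m * \<theta>)"
      using \<theta> by (intro mean_delay_le_blocks[OF \<rho> pos _ first later]) auto
    also have "\<dots> \<le> ennreal ((C + \<delta>) * b)"
    proof (rule ennreal_leI)
      have "2 * real m * \<theta> \<le> 2 * (K * b) * \<theta>" using mK \<theta> by (intro mult_right_mono) auto
      also have "\<dots> = \<delta>' * b" using K by (simp add: \<theta>_def)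
      finally show "real N + 2 * real m * \<theta> \<le> (C + \<delta>) * b"
        using le(1) b(3) by (simp add: \<delta>'_def algebra_simps)
    qed
    finally show ?case .
  qed
qed

end

theorem theorem6:
  fixes \<mu> :: "'a measure" and f :: "nat \<Rightarrow> 'a \<Rightarrow> real" and L h :: nat
    and d :: "real \<Rightarrow> nat \<Rightarrow> nat" and \<rho> :: "real \<Rightarrow> nat \<Rightarrow> real"
    and c :: "nat \<Rightarrow> ennreal" and I :: "nat \<Rightarrow> real"
  assumes L: "2 \<le> L"
    and dens: "\<And>i. i \<le> L \<Longrightarrow> prob_density \<mu> (f i)"
    and KL: "\<And>i. 1 \<le> i \<Longrightarrow> i \<le> L \<Longrightarrow> 0 < KL_div \<mu> (f i) (f 0) \<and> KL_div \<mu> (f i) (f 0) < \<infinity>"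
    and I: "\<And>i. I i = real_of_ereal (KL_div \<mu> (f i) (f 0))"
    and d_infty: "\<And>i. 1 \<le> i \<Longrightarrow> i < L \<Longrightarrow> filterlim (\<lambda>b. d b i) at_top at_top"
    and d_asymp: "\<And>i. 1 \<le> i \<Longrightarrow> i < L \<Longrightarrow>
                    ((\<lambda>b. ennreal (real (d b i) * I i / b)) \<longlongrightarrow> c i) at_top"
    and c_L: "c L = \<infinity>"
    and \<rho>_range: "\<And>b i. 0 < b \<Longrightarrow> 1 \<le> i \<Longrightarrow> i < L \<Longrightarrow> 0 < \<rho> b i \<and> \<rho> b i < 1"
    and \<rho>_zero: "\<And>i. 1 \<le> i \<Longrightarrow> i < L \<Longrightarrow> ((\<lambda>b. \<rho> b i) \<longlongrightarrow> 0) at_top"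
    and \<rho>_log: "\<And>i. 1 \<le> i \<Longrightarrow> i < L \<Longrightarrow> ((\<lambda>b. - ln (\<rho> b i) / b) \<longlongrightarrow> 0) at_top"
    and h: "h = Min {j \<in> {1..L}. (\<Sum>i=1..j. c i) \<ge> 1}"
  shows "\<exists>\<epsilon> :: real \<Rightarrow> real. (\<epsilon> \<longlongrightarrow> 0) at_top \<and>
    (\<forall>\<^sub>F b in at_top.
       lorden_delay \<mu> f L (d b) (dcusum_time f L b) = pollak_delay \<mu> f L (d b) (dcusum_time f L b) \<and>
       pollak_delay \<mu> f L (d b) (dcusum_time f L b)
         \<le> lorden_delay \<mu> f L (d b) (wdcusum_time f L (\<rho> b) b) \<and>
       lorden_delay \<mu> f L (d b) (wdcusum_time f L (\<rho> b) b)
         = pollak_delay \<mu> f L (d b) (wdcusum_time f L (\<rho> b) b) \<and>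
       pollak_delay \<mu> f L (d b) (wdcusum_time f L (\<rho> b) b)
         \<le> ennreal b * ((\<Sum>i=1..<h. c i / ennreal (I i))
                          + (1 - (\<Sum>i=1..<h. c i)) / ennreal (I h)) * ennreal (1 + \<epsilon> b))"
proof -
  interpret kl_model \<mu> f L
    by unfold_locales (use L dens KL in auto)
  have I_info: "I i = info i" for i by (simp add: I info_def)
  \<comment> \<open>Since \<open>c L\<close> is infinite, L belongs to the set, so its minimum is
    attained.\<close>
  have hset: "h \<in> {j \<in> {1..L}. (\<Sum>i=1..j. c i) \<ge> 1}"
  proof -
    have "c L \<le> (\<Sum>i=1..L. c i)" using L by (intro member_le_sum) auto
    moreover have "1 \<le> c L" by (simp add: c_L)
    ultimately have "1 \<le> (\<Sum>i=1..L. c i)" by (rule order_trans[rotated])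
    then have "L \<in> {j \<in> {1..L}. (\<Sum>i=1..j. c i) \<ge> 1}" using L by simp
    then show ?thesis unfolding h by (intro Min_in) auto
  qed
  then have h1: "1 \<le> h" "h \<le> L" and ge1: "1 \<le> (\<Sum>i=1..h. c i)" by auto
  have lt1: "(\<Sum>i=1..<h. c i) < 1"
  proof (rule ccontr)
    assume ge: "\<not> (\<Sum>i=1..<h. c i) < 1"
    then have "h \<noteq> 1" by auto
    then have h2: "{1..<h} = {1..h - 1}" "1 \<le> h - 1" using h1 by auto
    have "h \<le> h - 1"
      by (subst h, rule Min_le) (use ge h1 h2 in \<open>auto simp del: One_nat_def\<close>)
    then show False using h1 by simp
  qed
  \<comment> \<open>By minimality of h the shares before h sum to less than 1, so they are finite
    and lose nothing as reals. The value 0 elsewhere keeps all of them nonnegative.\<close>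
  define c' where "c' i = (if i \<in> {1..<h} then enn2real (c i) else 0)" for i
  define s where "s = (\<Sum>i=1..<h. c' i)"
  have c': "c i = ennreal (c' i)" if i: "i \<in> {1..<h}" for i
  proof -
    have "c i \<le> (\<Sum>i=1..<h. c i)" using i by (intro member_le_sum) auto
    with lt1 have "c i < \<top>" by (meson le_less_trans less_top_ennreal ennreal_one_less_top order_less_trans)
    then show ?thesis using i by (simp add: c'_def)
  qed
  have c'0: "0 \<le> c' i" for i by (simp add: c'_def)
  have s_sum: "(\<Sum>i=1..<h. c i) = ennreal s"
    unfolding s_def using c' c'0 by (simp add: sum_ennreal[symmetric] del: sum_ennreal One_nat_def)
  have s0: "0 \<le> s" using c'0 by (simp add: s_def sum_nonneg)
  have s1: "s < 1" using lt1 s0 unfolding s_sum by (simp add: ennreal_less_one_iff)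
  have nonneg: "\<forall>\<^sub>F b in at_top. 0 \<le> real (d b i) * info i / b" if "1 \<le> i" "i \<le> L" for i
    using eventually_gt_at_top[of 0] by eventually_elim (use info_pos[OF that] in auto)
  have lim: "((\<lambda>b. real (d b i) * info i / b) \<longlongrightarrow> c' i) at_top" if i: "1 \<le> i" "i < h" for i
    using d_asymp[of i] c'[of i] i h1 nonneg[of i] c'0
    by (intro tendsto_ennrealD) (auto simp: I_info)
  \<comment> \<open>The share of regime h is at least 1 - s but possibly infinite, so only this
    one-sided bound is extracted. When 1 - s - \<eta> is negative it holds trivially.\<close>
  have lim_h: "\<forall>\<^sub>F b in at_top. 1 - s - \<eta> \<le> real (d b h) * info h / b" if hL: "h < L" and \<eta>: "0 < \<eta>" for \<eta>
  proof (cases "0 \<le> 1 - s - \<eta>")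
    case True
    have "{1..h} = insert h {1..<h}" using h1 by auto
    then have "1 \<le> ennreal s + c h" using ge1 s_sum by (simp add: add.commute del: One_nat_def)
    then have "ennreal (1 - s) \<le> c h"
      using s0 s1 by (metis add_diff_cancel_left' add.commute ennreal_1 ennreal_minus ennreal_minus_mono
          ennreal_add_diff_cancel_left ennreal_neq_top order_refl)
    moreover have "ennreal (1 - s - \<eta>) < ennreal (1 - s)"
      using True \<eta> by (intro ennreal_lessI) auto
    ultimately have "ennreal (1 - s - \<eta>) < c h" by (rule order_less_le_trans[rotated])
    from order_tendstoD(1)[OF d_asymp[OF h1(1) hL] this] nonneg[OF h1]
    show ?thesis
    proof eventually_elim
      case (elim b)
      then show ?case using True by (simp add: I_info ennreal_less_iff)
    qed
  next
    case False
    from nonneg[OF h1] show ?thesis by eventually_elim (use False in auto)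
  qed
  define C where "C = (\<Sum>i=1..<h. c' i / info i) + (1 - s) / info h"
  \<comment> \<open>C > 0, a consequence of s < 1, turns the additive error o(b) into a factor 1 +
    o(1).\<close>
  have "0 < (1 - s) / info h" using s1 h1 info_pos by simp
  moreover have "0 \<le> (\<Sum>i=1..<h. c' i / info i)"
    using c'0 h1 info_pos by (intro sum_nonneg divide_nonneg_nonneg) (auto intro: less_imp_le)
  ultimately have C: "0 < C" unfolding C_def by linarith
  have C_eq: "(\<Sum>i=1..<h. c i / ennreal (I i)) + (1 - (\<Sum>i=1..<h. c i)) / ennreal (I h) = ennreal C"
  proof -
    have "(\<Sum>i=1..<h. c i / ennreal (I i)) = (\<Sum>i=1..<h. ennreal (c' i / info i))"
      using c' c'0 h1 info_pos by (intro sum.cong refl) (simp add: I_info divide_ennreal)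
    also have "\<dots> = ennreal (\<Sum>i=1..<h. c' i / info i)"
      using c'0 h1 info_pos by (intro sum_ennreal divide_nonneg_nonneg) (auto intro: less_imp_le)
    finally have 1: "(\<Sum>i=1..<h. c i / ennreal (I i)) = ennreal (\<Sum>i=1..<h. c' i / info i)" .
    have "1 - (\<Sum>i=1..<h. c i) = ennreal (1 - s)"
      unfolding s_sum using s0 by (metis ennreal_1 ennreal_minus)
    then have 2: "(1 - (\<Sum>i=1..<h. c i)) / ennreal (I h) = ennreal ((1 - s) / info h)"
      using s1 h1 info_pos by (simp add: I_info divide_ennreal)
    show ?thesis
      unfolding 1 2 C_def using \<open>0 \<le> (\<Sum>i=1..<h. c' i / info i)\<close> \<open>0 < (1 - s) / info h\<close>
      by (intro ennreal_plus[symmetric]) auto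
  qed
  define M where "M b = (\<integral>\<^sup>+\<omega>. ennreal_of_enat (wdcusum_time f L (\<rho> b) b \<omega> - 1) \<partial>change_measure \<mu> f L (d b) 1)" for b
  have M_le: "\<forall>\<^sub>F b in at_top. M b \<le> ennreal ((C + \<delta>) * b)" if "0 < \<delta>" for \<delta>
    unfolding M_def C_def s_def
    by (rule mean_delay_eventually[OF h1 lim c'0 _ _ \<rho>_range \<rho>_zero \<rho>_log that])
       (use s1 lim_h in \<open>auto simp: s_def\<close>)
  \<comment> \<open>The relative excess of the mean delay over C b, cut at 0. The cut settles the
    lower half of the convergence; for the upper half, slack C a / 2 bounds it by a / 2.\<close>
  define \<epsilon> where "\<epsilon> b = max 0 (enn2real (M b) / (C * b) - 1)" for b
  have "(\<epsilon> \<longlongrightarrow> 0) at_top"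
  proof (rule order_tendstoI)
    fix a :: real assume "0 < a"
    then have "0 < C * (a / 2)" using C by simp
    from M_le[OF this] eventually_gt_at_top[of 0] show "\<forall>\<^sub>F b in at_top. \<epsilon> b < a"
    proof eventually_elim
      case (elim b)
      have "0 \<le> (C + C * (a / 2)) * b" using C \<open>0 < a\<close> elim by simp
      then have "enn2real (M b) \<le> (C + C * (a / 2)) * b"
        using elim(1) by (simp add: enn2real_leI)
      also have "\<dots> = (1 + a / 2) * (C * b)" by (simp add: algebra_simps)
      finally have "enn2real (M b) / (C * b) \<le> 1 + a / 2"
        using C elim(2) by (simp add: divide_le_eq)
      then show ?case using \<open>0 < a\<close> by (simp add: \<epsilon>_def)
    qed
  qed (auto simp: \<epsilon>_def intro!: always_eventually)
  moreover have "\<forall>\<^sub>F b in at_top.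
       lorden_delay \<mu> f L (d b) (dcusum_time f L b) = pollak_delay \<mu> f L (d b) (dcusum_time f L b) \<and>
       pollak_delay \<mu> f L (d b) (dcusum_time f L b)
         \<le> lorden_delay \<mu> f L (d b) (wdcusum_time f L (\<rho> b) b) \<and>
       lorden_delay \<mu> f L (d b) (wdcusum_time f L (\<rho> b) b)
         = pollak_delay \<mu> f L (d b) (wdcusum_time f L (\<rho> b) b) \<and>
       pollak_delay \<mu> f L (d b) (wdcusum_time f L (\<rho> b) b)
         \<le> ennreal b * ((\<Sum>i=1..<h. c i / ennreal (I i))
                          + (1 - (\<Sum>i=1..<h. c i)) / ennreal (I h)) * ennreal (1 + \<epsilon> b)"
    using M_le[OF zero_less_one] eventually_gt_at_top[of 0]
  proof eventually_elim
    case (elim b)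
    interpret D: suffix_rule_model \<mu> f L "\<lambda>k X. ereal b < dcusum_stat f L k X"
      by (rule dcusum_rule)
    interpret W: suffix_rule_model \<mu> f L "\<lambda>k X. ereal b \<le> wdcusum_stat f L (\<rho> b) k X"
      by (rule wdcusum_rule)
    have times: "dcusum_time f L b = D.rule_time" "wdcusum_time f L (\<rho> b) b = W.rule_time"
      by (simp_all add: fun_eq_iff dcusum_time_def D.rule_time_def wdcusum_time_def W.rule_time_def)
    have le: "D.rule_time \<omega> \<le> W.rule_time \<omega>" for \<omega>
      unfolding times[symmetric] using elim(2) \<rho>_range by (intro dcusum_time_le_wdcusum_time) auto
    have "D.rule_time \<omega> - 1 \<le> W.rule_time \<omega> - 1" for \<omega>
      using le[of \<omega>] by (cases "D.rule_time \<omega>"; cases "W.rule_time \<omega>") (auto simp: one_enat_def)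
    then have mono: "D.mean_delay (d b) \<le> W.mean_delay (d b)"
      unfolding D.mean_delay_def W.mean_delay_def by (intro nn_integral_mono) simp
    have MW: "W.mean_delay (d b) = M b" by (simp add: M_def W.mean_delay_def times)
    \<comment> \<open>\<open>enn2real\<close> maps \<infinity> to 0, so \<epsilon> controls
      \<open>M b\<close> only once finiteness is known; the bound with slack 1 provides it.\<close>
    have "M b < \<top>" using elim(1) by (rule order_le_less_trans) simp
    then have "M b = ennreal (enn2real (M b))" by simp
    also have "\<dots> \<le> ennreal (b * C * (1 + \<epsilon> b))"
    proof (rule ennreal_leI)
      have "enn2real (M b) / (C * b) \<le> 1 + \<epsilon> b" by (simp add: \<epsilon>_def)
      then show "enn2real (M b) \<le> b * C * (1 + \<epsilon> b)"
        using C elim(2) by (simp add: divide_le_eq mult_ac)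
    qed
    also have "\<dots> = ennreal b * ennreal C * ennreal (1 + \<epsilon> b)"
      using C elim(2) by (simp add: ennreal_mult \<epsilon>_def)
    finally have "M b \<le> ennreal b * ennreal C * ennreal (1 + \<epsilon> b)" .
    then show ?case
      unfolding C_eq times D.lorden_delay_eq D.pollak_delay_eq W.lorden_delay_eq W.pollak_delay_eq
      using mono MW by simp
  qed
  ultimately show ?thesis by blast
qed

end
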